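(* Let $B\in\mathbb{R}^{n\times n}$ be the cubic B-spline collocation matrix associated with parameters $t_1<t_2<\cdots<t_n$, and let $Q=I+S$ be the preconditioner, where $S$ carries the negatives of the super-diagonal entries of $B$ (both as defined in the context). Let $\lambda_1(QB),\ldots,\lambda_n(QB)$ be the eigenvalues of $QB$. When $$\omega=\frac{2}{\min_{1\le i\le n}|\lambda_i(QB)|+\max_{1\le i\le n}|\lambda_i(QB)|},$$ the preconditioned WPIA $$\boldsymbol{p}^{(k+1)}=(I-\omega QB)\,\boldsymbol{p}^{(k)}+\omega Q\boldsymbol{p},\qquad k=0,1,2,\ldots,$$ converges, i.e. $\rho(I-\omega QB)<1$, and has the fastest convergence, i.e. this $\omega$ minimizes $\rho(I-\omega' QB)$ over all relaxation factors $\omega'\in\mathbb{C}$.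
   Context: Data: points $\boldsymbol{p}_1,\ldots,\boldsymbol{p}_n$ in $\mathbb{R}^2$ or $\mathbb{R}^3$ with parameters $t_1<t_2<\cdots<t_n$. Extend the parameters to the knot vector $\{t_i\}_{i=-2}^{n+3}$ with $t_{-2}=t_{-1}=t_0=t_1<t_2<\cdots<t_n=t_{n+1}=t_{n+2}=t_{n+3}$. Let $\{N_i^3(t)\}_{i=-2}^{n-1}$ be the (normalized) cubic B-spline basis on this knot vector, where $N_i^3$ has support $[t_i,t_{i+4}]$. Collocation matrix: $B=(b_{ij})\in\mathbb{R}^{n\times n}$ is the tridiagonal matrix with $b_{11}=1$, $b_{12}=0$, $b_{n,n-1}=0$, $b_{nn}=1$, and for $2\le i\le n-1$: $b_{i,i-1}=N_{i-3}^3(t_i)$, $b_{ii}=N_{i-2}^3(t_i)$, $b_{i,i+1}=N_{i-1}^3(t_i)$; all other entries are $0$. Preconditioner: $Q=I+S$, where $S$ has entries $S_{i,i+1}=-b_{i,i+1}$ for $1\le i\le n-1$ (so $S_{12}=0$) and all other entries $0$. Write $\boldsymbol{p}=[\boldsymbol{p}_1,\ldots,\boldsymbol{p}_n]^T$ (one data point per row), and $\boldsymbol{p}^{(k)}=[\boldsymbol{p}_1^{(k)},\ldots,\boldsymbol{p}_n^{(k)}]^T$ for the control points at step $k$. $\rho(\cdot)$ is the spectral radius. A stationary iteration $\boldsymbol{x}^{(k+1)}=G\boldsymbol{x}^{(k)}+\boldsymbol{c}$ is called convergent if its iteration matrix $G$ satisfies $\rho(G)<1$; among a family of such iterations, the fastest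 convergence is attained by one whose iteration matrix has the smallest spectral radius. *)

theory Defs
  imports Complex_Main "Jordan_Normal_Form.Spectral_Radius"
begin

text \<open>Parameters are indexed from 1, so only \<open>t 1, \<dots>, t n\<close> matter.  The end knots are
  repeated to multiplicity four; constant extension to all of the integers gives the intended
  values on the indices \<open>-2, \<dots>, n + 3\<close>.\<close>

definition knot :: "nat \<Rightarrow> (nat \<Rightarrow> real) \<Rightarrow> int \<Rightarrow> real" where
  "knot n t i = (if i < 1 then t 1 else if i > int n then t n else t (nat i))"

text \<open>Cox--de Boor recursion: \<open>bspline u k i\<close> is the normalized B-spline of degree \<open>k\<close> supported
  on \<open>[u i, u (i + k + 1)]\<close>.  The usual convention 0/0 = 0 at repeated knots agrees with division
  in HOL.  With half-open intervals in degree 0 all functions vanish at the last knot, but the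
  collocation matrix evaluates B-splines at interior parameters only.\<close>

fun bspline :: "(int \<Rightarrow> real) \<Rightarrow> nat \<Rightarrow> int \<Rightarrow> real \<Rightarrow> real" where
  "bspline u 0 i x = (if u i \<le> x \<and> x < u (i + 1) then 1 else 0)"
| "bspline u (Suc k) i x =
     (x - u i) / (u (i + int (Suc k)) - u i) * bspline u k i x
   + (u (i + int (Suc k) + 1) - x) / (u (i + int (Suc k) + 1) - u (i + 1))
       * bspline u k (i + 1) x"

definition N3 :: "nat \<Rightarrow> (nat \<Rightarrow> real) \<Rightarrow> int \<Rightarrow> real \<Rightarrow> real" where
  "N3 n t = bspline (knot n t) 3"

text \<open>Entry \<open>(i, j)\<close> of the collocation matrix, with row and column indices from 1.\<close>

definition colloc_entry :: "nat \<Rightarrow> (nat \<Rightarrow> real) \<Rightarrow> nat \<Rightarrow> nat \<Rightarrow> real" where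
  "colloc_entry n t i j =
     (if i = 1 \<or> i = n then (if j = i then 1 else 0)
      else if j + 1 = i then N3 n t (int i - 3) (t i)
      else if j = i then N3 n t (int i - 2) (t i)
      else if j = i + 1 then N3 n t (int i - 1) (t i)
      else 0)"

text \<open>Matrix indices of the library start at 0.\<close>

definition colloc_mat :: "nat \<Rightarrow> (nat \<Rightarrow> real) \<Rightarrow> real mat" where
  "colloc_mat n t = mat n n (\<lambda>(i, j). colloc_entry n t (i + 1) (j + 1))"

definition superdiag_mat :: "nat \<Rightarrow> (nat \<Rightarrow> real) \<Rightarrow> real mat" where
  "superdiag_mat n t =
     mat n n (\<lambda>(i, j). if j = i + 1 then - (colloc_mat n t $$ (i, j)) else 0)"

definition precond_mat :: "nat \<Rightarrow> (nat \<Rightarrow> real) \<Rightarrow> real mat" where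
  "precond_mat n t = 1\<^sub>m n + superdiag_mat n t"

abbreviation cmat :: "real mat \<Rightarrow> complex mat" where
  "cmat \<equiv> map_mat complex_of_real"

text \<open>The pair \<open>(G, c)\<close> stands for the iteration \<open>X (k + 1) = G * X k + c\<close>.
  The unknown has one row per control point, so \<open>c\<close> is a matrix as well.\<close>

type_synonym stationary_iteration = "complex mat \<times> complex mat"

definition iteration_matrix :: "stationary_iteration \<Rightarrow> complex mat" where
  "iteration_matrix = fst"

definition convergent_iteration :: "stationary_iteration \<Rightarrow> bool" where
  "convergent_iteration I \<longleftrightarrow> spectral_radius (iteration_matrix I) < 1"

definition fastest_iteration :: "stationary_iteration \<Rightarrow> stationary_iteration set \<Rightarrow> bool" where
  "fastest_iteration I \<F> \<longleftrightarrow> I \<in> \<F> \<and>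
     (\<forall>J\<in>\<F>. spectral_radius (iteration_matrix I) \<le> spectral_radius (iteration_matrix J))"

definition precond_wpia ::
    "nat \<Rightarrow> (nat \<Rightarrow> real) \<Rightarrow> real mat \<Rightarrow> complex \<Rightarrow> stationary_iteration" where
  "precond_wpia n t p \<omega> =
     (1\<^sub>m n - \<omega> \<cdot>\<^sub>m cmat (precond_mat n t * colloc_mat n t),
      \<omega> \<cdot>\<^sub>m cmat (precond_mat n t * p))"

end

theory Submission
  imports Defs
begin

text \<open>The eigenvalues of \<open>Q B\<close> need not be real, so the familiar optimality argument for a
  positive real spectrum does not apply as it stands. What replaces it: all eigenvalues lie in a
  disc that touches the spectrum at both ends of its real diameter.

  Rows \<open>1\<close> and \<open>n\<close> of \<open>Q B\<close> are rows of the identity. Hence 1 is an eigenvalue, and an eigenvector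
  for any other eigenvalue vanishes at both ends and satisfies the equations of the interior rows
  only. On those rows two independent estimates confine an eigenvalue \<open>z\<close>, each to a sector of
  half-angle 30 degrees.

  The sector with vertex 1 (\<open>eigenvalue_bound_above\<close>). The interior of \<open>B\<close> is self-adjoint and
  positive definite for a weighted inner product. If \<open>w = B v\<close> for an eigenvector \<open>v\<close> of \<open>Q B\<close>, then
  \<open>z \<langle>v, B v\<rangle> = \<langle>w, w\<rangle> - \<sigma>\<close>, where \<open>\<sigma>\<close> collects the superdiagonal terms of \<open>\<langle>w, B w\<rangle>\<close>. Positivity of
  the form at \<open>v - w\<close> and the row sums 1 of \<open>B\<close> bound \<open>\<langle>v, B v\<rangle>\<close> from below in terms of \<open>\<sigma>\<close>, and that
  places \<open>1 - z\<close> in the sector.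

  The sector with vertex \<open>m\<close>, the smallest eigenvalue (\<open>smallest_eigenvalue\<close>). After conjugation
  with alternating signs, the interior of \<open>Q B\<close> has non-positive off-diagonal entries, on one
  subdiagonal and two superdiagonals. It therefore has a real eigenvalue \<open>m\<close> with positive left and
  right eigenvectors (\<open>perron_pair\<close>). Scaling by these turns the matrix minus \<open>m\<close> into the
  generator of a Markov chain with a stationary distribution, in which a step down has length one
  and a step up has length one or two. Its stationary flow splits into cycles of length two and
  three. A two-cycle contributes a non-negative real number to the Dirichlet form, and a
  three-cycle a number in the sector, because a triangle has area at most
  \<open>1 / (4 \<surd>3)\<close> times the sum of its squared sides (\<open>sector_three_cycle\<close>). Hence
  \<open>z - m\<close> lies in the sector (\<open>dirichlet_sector\<close>).

  Together these give \<open>3 (Im z)\<^sup>2 \<le> (1 - Re z) (Re z - m)\<close>, so \<open>z\<close> lies in the disc with diameter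
  from \<open>m\<close> to 1 (\<open>disc_if_sectors\<close>). As \<open>m\<close> and 1 are eigenvalues, they are the least and the greatest
  modulus, \<open>\<omega> = 2 / (1 + m)\<close>, and \<open>\<rho>(I - \<omega> Q B) = (1 - m) / (1 + m) < 1\<close>. No \<open>\<omega>'\<close> does better, since
  \<open>1 - m = (1 - \<omega>' m) - m (1 - \<omega>')\<close> forces one of the eigenvalues \<open>1 - \<omega>' m\<close> and \<open>1 - \<omega>'\<close> of the
  iteration matrix to have modulus at least \<open>(1 - m) / (1 + m)\<close>.\<close>

section \<open>A sector of half-angle 30 degrees\<close>

definition sector :: "complex \<Rightarrow> bool" where
  "sector z \<longleftrightarrow> sqrt 3 * \<bar>Im z\<bar> \<le> Re z"

lemma sector_0: "sector 0"
  by (simp add: sector_def)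

lemma sector_add: "sector x \<Longrightarrow> sector y \<Longrightarrow> sector (x + y)"
proof -
  have "sqrt 3 * \<bar>Im x + Im y\<bar> \<le> sqrt 3 * (\<bar>Im x\<bar> + \<bar>Im y\<bar>)"
    by (intro mult_left_mono) auto
  then show "sector x \<Longrightarrow> sector y \<Longrightarrow> sector (x + y)"
    by (simp add: sector_def distrib_left)
qed

lemma sector_sum: "(\<And>i. i \<in> S \<Longrightarrow> sector (f i)) \<Longrightarrow> sector (sum f S)"
  by (induction S rule: infinite_finite_induct) (auto simp: sector_0 sector_add)

lemma sector_scale_iff:
  assumes "0 < c"
  shows "sector (of_real c * z) \<longleftrightarrow> sector z"
proof -
  have "sqrt 3 * \<bar>Im (of_real c * z)\<bar> = c * (sqrt 3 * \<bar>Im z\<bar>)"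
    using assms by (simp add: abs_mult)
  then show ?thesis
    using assms by (simp add: sector_def)
qed

lemma sector_scale: "0 \<le> c \<Longrightarrow> sector z \<Longrightarrow> sector (of_real c * z)"
  by (cases "c = 0") (auto simp: sector_0 sector_scale_iff)

text \<open>The left-hand side is \<open>\<bar>a - b\<bar>\<^sup>2\<close>: back and forth along one edge is a reversible motion.\<close>

lemma sector_two_cycle: "sector (cnj a * (a - b) + cnj b * (b - a))"
proof -
  have "cnj a * (a - b) + cnj b * (b - a) = of_real ((cmod (a - b))\<^sup>2)"
    unfolding complex_norm_square by (simp add: algebra_simps)
  then show ?thesis
    by (simp add: sector_def)
qed

text \<open>The real part is half the sum of the squared sides of the triangle \<open>a, b, c\<close>, and the
  imaginary part is plus or minus twice its area. The claim is Weitzenboeck's inequality, with equality for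
  equilateral triangles; this is where the angle of 30 degrees comes from.\<close>

lemma sector_three_cycle:
  "sector (cnj a * (a - c) + cnj c * (c - b) + cnj b * (b - a))"
proof -
  define x1 x2 y1 y2 where
    "x1 = Re a - Re b" "x2 = Im a - Im b" "y1 = Re c - Re b" "y2 = Im c - Im b"
  define S d k where "S = x1\<^sup>2 + x2\<^sup>2 + y1\<^sup>2 + y2\<^sup>2" "d = x1 * y1 + x2 * y2" "k = x1 * y2 - x2 * y1"
  have Re: "Re (cnj a * (a - c) + cnj c * (c - b) + cnj b * (b - a)) = S - d"
    by (simp add: S_d_k_def x1_x2_y1_y2_def power2_eq_square algebra_simps)
  have Im: "Im (cnj a * (a - c) + cnj c * (c - b) + cnj b * (b - a)) = - k"
    by (simp add: S_d_k_def x1_x2_y1_y2_def power2_eq_square algebra_simps)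
  have "2 * \<bar>d\<bar> \<le> S"
  proof -
    have "0 \<le> (x1 - y1)\<^sup>2 + (x2 - y2)\<^sup>2" "0 \<le> (x1 + y1)\<^sup>2 + (x2 + y2)\<^sup>2" by simp_all
    then have "2 * d \<le> S" "2 * (- d) \<le> S"
      unfolding S_d_k_def power2_eq_square by (simp_all add: algebra_simps)
    then show ?thesis by linarith
  qed
  then have pos: "0 \<le> S - d" by linarith
  \<comment> \<open>Here \<open>d\<close> and \<open>k\<close> are dot and cross product of the sides at \<open>b\<close>, so \<open>d\<^sup>2 + k\<^sup>2\<close> is the product of their squares.\<close>
  have "4 * ((S - d)\<^sup>2 - 3 * k\<^sup>2) = (S - 4 * d)\<^sup>2 + 3 * (x1\<^sup>2 + x2\<^sup>2 - y1\<^sup>2 - y2\<^sup>2)\<^sup>2"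
    unfolding S_d_k_def by (simp add: power2_eq_square algebra_simps)
  then have "0 \<le> 4 * ((S - d)\<^sup>2 - 3 * k\<^sup>2)"
    by simp
  then have "3 * k\<^sup>2 \<le> (S - d)\<^sup>2"
    by simp
  then have "(sqrt 3 * \<bar>k\<bar>)\<^sup>2 \<le> (S - d)\<^sup>2"
    by (simp add: power_mult_distrib)
  then have "sqrt 3 * \<bar>k\<bar> \<le> S - d"
    using pos power2_le_imp_le by blast
  then show ?thesis
    unfolding sector_def Re Im by simp
qed

text \<open>Think of \<open>p i\<close>, \<open>k i\<close> and \<open>q i\<close> as the stationary flows \<open>i \<rightarrow> i + 1\<close>, \<open>i \<rightarrow> i + 2\<close> and
  \<open>i + 1 \<rightarrow> i\<close> of a chain. The assumption on \<open>q\<close> says that no net flow crosses the cut between \<open>i + 1\<close>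
  and \<open>i + 2\<close>, where the long steps from \<open>i\<close> and from \<open>i + 1\<close> both count. It lets each upward step be closed
  by downward unit steps, so that the form becomes a sum over cycles. The two terms outside the sum on the
  left are the downward flow that the first \<open>N\<close> rows still owe to their cycles; they make the
  identity provable by induction on \<open>N\<close>, and vanish once \<open>N\<close> is the last state.\<close>

lemma circulation_sum:
  fixes f :: "nat \<Rightarrow> complex" and p q k :: "nat \<Rightarrow> real" and F :: "nat \<Rightarrow> nat \<Rightarrow> complex"
  defines "F \<equiv> \<lambda>i j. cnj (f i) * (f i - f j)"
  assumes zero: "q 0 = 0" "k 0 = 0"
    and cut: "\<And>i. q (Suc i) = p (Suc i) + k (Suc i) + k i"
  shows "(\<Sum>i<N. q i * F (Suc i) i + p (Suc i) * F (Suc i) (Suc (Suc i)) + k (Suc i) * F (Suc i) (Suc (Suc (Suc i))))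
       + q N * F (Suc N) N + k N * F (Suc (Suc N)) (Suc N)
       = (\<Sum>i<N. p (Suc i) * (F (Suc i) (Suc (Suc i)) + F (Suc (Suc i)) (Suc i))
              + k (Suc i) * (F (Suc i) (Suc (Suc (Suc i))) + F (Suc (Suc (Suc i))) (Suc (Suc i)) + F (Suc (Suc i)) (Suc i)))"
proof (induction N)
  case 0
  show ?case by (simp add: zero)
next
  case (Suc N)
  have c: "complex_of_real (q (Suc N)) = p (Suc N) + k (Suc N) + k N"
    by (simp only: cut of_real_add)
  have step: "A + (x + y + u) + q (Suc N) * F (Suc (Suc N)) (Suc N) + r
      = R + (p (Suc N) * (F (Suc N) (Suc (Suc N)) + F (Suc (Suc N)) (Suc N)) + k (Suc N) * (F (Suc N) (Suc (Suc (Suc N))) + F (Suc (Suc (Suc N))) (Suc (Suc N)) + F (Suc (Suc N)) (Suc N)))"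
    if "A + x + k N * F (Suc (Suc N)) (Suc N) = R" "y = p (Suc N) * F (Suc N) (Suc (Suc N))"
      "u = k (Suc N) * F (Suc N) (Suc (Suc (Suc N)))" "r = k (Suc N) * F (Suc (Suc (Suc N))) (Suc (Suc N))"
    for A x y u r R
    unfolding c that(1)[symmetric] that(2-) by (simp only: of_real_add algebra_simps)
  show ?case
    unfolding sum.lessThan_Suc by (rule step[OF Suc refl refl refl])
qed

text \<open>Substituting \<open>v = w f\<close> turns the matrix minus \<open>m\<close> into a generator, which acts on differences
  of \<open>f\<close> only. Summing the eigenvalue equation against \<open>l w cnj f\<close> expresses \<open>z - m\<close>, up to a positive
  factor, by the cycles of \<open>circulation_sum\<close>.\<close>

lemma dirichlet_sector:
  fixes v :: "nat \<Rightarrow> complex" and l w s \<alpha> \<beta> \<kappa> :: "nat \<Rightarrow> real"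
  assumes l_pos: "\<And>i. 1 \<le> i \<Longrightarrow> i \<le> K \<Longrightarrow> 0 < l i"
    and w_pos: "\<And>i. 1 \<le> i \<Longrightarrow> i \<le> K \<Longrightarrow> 0 < w i"
    and l0: "l 0 = 0" "\<And>i. K < i \<Longrightarrow> l i = 0"
    and w0: "w 0 = 0" "\<And>i. K < i \<Longrightarrow> w i = 0"
    and v0: "v 0 = 0" "\<And>i. K < i \<Longrightarrow> v i = 0"
    and \<beta>: "\<And>i. 1 \<le> i \<Longrightarrow> i \<le> K \<Longrightarrow> 0 \<le> \<beta> i"
    and \<kappa>: "\<And>i. 1 \<le> i \<Longrightarrow> i \<le> K \<Longrightarrow> 0 \<le> \<kappa> i"
    and right: "\<And>i. i < K \<Longrightarrow> (s (Suc i) - m) * w (Suc i)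
        = \<alpha> (Suc i) * w i + \<beta> (Suc i) * w (Suc (Suc i)) + \<kappa> (Suc i) * w (Suc (Suc (Suc i)))"
    and cut: "\<And>i. Suc i < K \<Longrightarrow> l (Suc (Suc i)) * \<alpha> (Suc (Suc i)) * w (Suc i)
        = l (Suc i) * \<beta> (Suc i) * w (Suc (Suc i)) + l (Suc i) * \<kappa> (Suc i) * w (Suc (Suc (Suc i)))
          + l i * \<kappa> i * w (Suc (Suc i))"
    and eig: "\<And>i. i < K \<Longrightarrow> z * v (Suc i)
        = s (Suc i) * v (Suc i) - \<alpha> (Suc i) * v i - \<beta> (Suc i) * v (Suc (Suc i)) - \<kappa> (Suc i) * v (Suc (Suc (Suc i)))"
    and nz: "v j \<noteq> 0"
  shows "sector (z - of_real m)"
proof -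
  define f where "f i = (if i = 0 \<or> K < i then 0 else v i / of_real (w i))" for i
  define p q k where "p i = l i * \<beta> i * w (Suc i)" and "q i = l (Suc i) * \<alpha> (Suc i) * w i"
    and "k i = l i * \<kappa> i * w (Suc (Suc i))" for i
  define F :: "nat \<Rightarrow> nat \<Rightarrow> complex" where "F i j = cnj (f i) * (f i - f j)" for i j
  have v: "v i = w i * f i" for i
    using w_pos[of i] v0 by (auto simp: f_def)
  have cut': "q (Suc i) = p (Suc i) + k (Suc i) + k i" for i
  proof (cases "Suc i < K")
    case True
    then show ?thesis using cut[of i] by (simp add: p_def q_def k_def)
  next
    case False
    then show ?thesis by (simp add: p_def q_def k_def l0 w0)
  qed
  have nonneg: "0 \<le> p (Suc i)" "0 \<le> k (Suc i)" if "i < K" for i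
    using that \<beta>[of "Suc i"] \<kappa>[of "Suc i"] l_pos[of "Suc i"] w_pos[of "Suc (Suc i)"] w_pos[of "Suc (Suc (Suc i))"]
      w0(2)[of "Suc (Suc i)"] w0(2)[of "Suc (Suc (Suc i))"]
    by (cases "Suc (Suc i) \<le> K"; cases "Suc (Suc (Suc i)) \<le> K";
        simp add: p_def k_def)+
  have row: "(z - m) * of_real (l (Suc i) * w (Suc i) * (cmod (f (Suc i)))\<^sup>2)
     = q i * F (Suc i) i + p (Suc i) * F (Suc i) (Suc (Suc i)) + k (Suc i) * F (Suc i) (Suc (Suc (Suc i)))"
    if "i < K" for i
  proof -
    have r: "complex_of_real (s (Suc i)) * w (Suc i)
        = m * w (Suc i) + \<alpha> (Suc i) * w i + \<beta> (Suc i) * w (Suc (Suc i)) + \<kappa> (Suc i) * w (Suc (Suc (Suc i)))"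
      unfolding of_real_mult[symmetric] of_real_add[symmetric] of_real_eq_iff
      using right[OF that] by (simp add: algebra_simps)
    have "z * (w (Suc i) * f (Suc i)) = (complex_of_real (s (Suc i)) * of_real (w (Suc i))) * f (Suc i)
        - \<alpha> (Suc i) * w i * f i - \<beta> (Suc i) * w (Suc (Suc i)) * f (Suc (Suc i)) - \<kappa> (Suc i) * w (Suc (Suc (Suc i))) * f (Suc (Suc (Suc i)))"
      using eig[OF that] unfolding v by (simp add: algebra_simps)
    then have "(z - m) * (w (Suc i) * f (Suc i))
      = \<alpha> (Suc i) * w i * (f (Suc i) - f i) + \<beta> (Suc i) * w (Suc (Suc i)) * (f (Suc i) - f (Suc (Suc i)))
        + \<kappa> (Suc i) * w (Suc (Suc (Suc i))) * (f (Suc i) - f (Suc (Suc (Suc i))))"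
      unfolding r by (simp add: algebra_simps)
    from arg_cong[OF this, of "\<lambda>x. x * (l (Suc i) * cnj (f (Suc i)))"]
    have "(z - m) * (w (Suc i) * f (Suc i)) * (l (Suc i) * cnj (f (Suc i)))
      = (\<alpha> (Suc i) * w i * (f (Suc i) - f i) + \<beta> (Suc i) * w (Suc (Suc i)) * (f (Suc i) - f (Suc (Suc i)))
        + \<kappa> (Suc i) * w (Suc (Suc (Suc i))) * (f (Suc i) - f (Suc (Suc (Suc i))))) * (l (Suc i) * cnj (f (Suc i)))" .
    then show ?thesis
      unfolding F_def p_def q_def k_def of_real_mult complex_norm_square
      by (simp only: algebra_simps)
  qed
  define n2 where "n2 = (\<Sum>i<K. l (Suc i) * w (Suc i) * (cmod (f (Suc i)))\<^sup>2)"
  have j: "1 \<le> j" "j \<le> K"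
    using nz v0 by (metis One_nat_def Suc_leI neq0_conv, metis leI nz v0(2))
  have "0 < n2"
    unfolding n2_def
  proof (rule sum_pos2[of _ "j - 1"])
    show "0 < l (Suc (j - 1)) * w (Suc (j - 1)) * (cmod (f (Suc (j - 1))))\<^sup>2"
      using j l_pos[of j] w_pos[of j] nz v[of j] by (auto intro!: mult_pos_pos)
    show "0 \<le> l (Suc i) * w (Suc i) * (cmod (f (Suc i)))\<^sup>2" if "i \<in> {..<K}" for i
      using that l_pos[of "Suc i"] w_pos[of "Suc i"] by simp
  qed (use j in auto)
  have "of_real n2 * (z - m) = (\<Sum>i<K. q i * F (Suc i) i + p (Suc i) * F (Suc i) (Suc (Suc i))
      + k (Suc i) * F (Suc i) (Suc (Suc (Suc i))))"
    unfolding n2_def of_real_sum sum_distrib_right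
    by (intro sum.cong refl) (subst mult.commute, subst row, auto)
  also have "\<dots> = (\<Sum>i<K. p (Suc i) * (F (Suc i) (Suc (Suc i)) + F (Suc (Suc i)) (Suc i))
      + k (Suc i) * (F (Suc i) (Suc (Suc (Suc i))) + F (Suc (Suc (Suc i))) (Suc (Suc i)) + F (Suc (Suc i)) (Suc i)))"
    using circulation_sum[where f = f and N = K and q = q and p = p and k = k, OF _ _ cut']
    by (simp add: F_def q_def k_def l0 w0)
  also have "sector \<dots>"
    unfolding F_def
    by (intro sector_sum sector_add sector_scale sector_two_cycle sector_three_cycle nonneg) auto
  finally show ?thesis
    using \<open>0 < n2\<close> sector_scale_iff by blast
qed

section \<open>Perron vectors of Hessenberg Z-matrices\<close>

text \<open>The equations of a left eigenvector for the value \<open>x\<close>, solved column by column from the first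
  entry 1. The value \<open>x\<close> is an eigenvalue of the leading \<open>K\<close> rows and columns iff entry \<open>K + 1\<close>
  vanishes. The subtraction \<open>j - 1\<close> at \<open>j = 0\<close> is harmless, as entry 0 is 0.\<close>

fun left_seq :: "(nat \<Rightarrow> real) \<Rightarrow> (nat \<Rightarrow> real) \<Rightarrow> (nat \<Rightarrow> real) \<Rightarrow> (nat \<Rightarrow> real) \<Rightarrow> real \<Rightarrow> nat \<Rightarrow> real" where
  "left_seq s \<alpha> \<beta> \<kappa> x 0 = 0"
| "left_seq s \<alpha> \<beta> \<kappa> x (Suc 0) = 1"
| "left_seq s \<alpha> \<beta> \<kappa> x (Suc (Suc j)) =
     ((s (Suc j) - x) * left_seq s \<alpha> \<beta> \<kappa> x (Suc j) - \<beta> j * left_seq s \<alpha> \<beta> \<kappa> x j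
       - \<kappa> (j - 1) * left_seq s \<alpha> \<beta> \<kappa> x (j - 1)) / \<alpha> (Suc (Suc j))"

lemma continuous_left_seq: "continuous_on S (\<lambda>x. left_seq s \<alpha> \<beta> \<kappa> x j)"
proof (induction j rule: less_induct)
  case (less j)
  consider "j = 0" | "j = Suc 0" | i where "j = Suc (Suc i)"
    by (metis old.nat.exhaust)
  then show ?case
  proof cases
    case (3 i)
    then have "continuous_on S (\<lambda>x. left_seq s \<alpha> \<beta> \<kappa> x (Suc i))"
      "continuous_on S (\<lambda>x. left_seq s \<alpha> \<beta> \<kappa> x i)"
      "continuous_on S (\<lambda>x. left_seq s \<alpha> \<beta> \<kappa> x (i - 1))"
      by (auto intro: less)
    then show ?thesis
      unfolding 3 left_seq.simps divide_inverse
      by (intro continuous_on_mult continuous_on_diff continuous_on_const continuous_on_id)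
  qed (simp_all add: continuous_on_const)
qed

text \<open>Far below the spectrum the diagonal dominates and the sequence increases.\<close>

lemma left_seq_pos_below:
  assumes \<alpha>: "\<And>i. 0 < \<alpha> i"
    and x: "\<And>j. j < K \<Longrightarrow> x \<le> s (Suc j) - \<alpha> (Suc (Suc j)) - \<bar>\<beta> j\<bar> - \<bar>\<kappa> (j - 1)\<bar>"
    and "j \<le> K"
  shows "0 < left_seq s \<alpha> \<beta> \<kappa> x (Suc j) \<and> left_seq s \<alpha> \<beta> \<kappa> x j \<le> left_seq s \<alpha> \<beta> \<kappa> x (Suc j)
    \<and> left_seq s \<alpha> \<beta> \<kappa> x (j - 1) \<le> left_seq s \<alpha> \<beta> \<kappa> x j
    \<and> 0 \<le> left_seq s \<alpha> \<beta> \<kappa> x j \<and> 0 \<le> left_seq s \<alpha> \<beta> \<kappa> x (j - 1)"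
  using \<open>j \<le> K\<close>
proof (induction j)
  case 0
  then show ?case by simp
next
  case (Suc j)
  let ?L = "left_seq s \<alpha> \<beta> \<kappa> x"
  have IH: "0 < ?L (Suc j)" "?L j \<le> ?L (Suc j)" "?L (j - 1) \<le> ?L j" "0 \<le> ?L j" "0 \<le> ?L (j - 1)"
    using Suc by auto
  have "\<alpha> (Suc (Suc j)) * ?L (Suc j) \<le> (s (Suc j) - x - \<bar>\<beta> j\<bar> - \<bar>\<kappa> (j - 1)\<bar>) * ?L (Suc j)"
    using x[of j] Suc.prems IH by (intro mult_right_mono) auto
  also have "\<dots> = (s (Suc j) - x) * ?L (Suc j) - \<bar>\<beta> j\<bar> * ?L (Suc j) - \<bar>\<kappa> (j - 1)\<bar> * ?L (Suc j)"
    by (simp add: algebra_simps)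
  also have "\<dots> \<le> (s (Suc j) - x) * ?L (Suc j) - \<beta> j * ?L j - \<kappa> (j - 1) * ?L (j - 1)"
  proof -
    have "\<beta> j * ?L j \<le> \<bar>\<beta> j\<bar> * ?L (Suc j)" "\<kappa> (j - 1) * ?L (j - 1) \<le> \<bar>\<kappa> (j - 1)\<bar> * ?L (Suc j)"
      using IH by (auto intro!: mult_mono)
    then show ?thesis by linarith
  qed
  finally have "?L (Suc j) \<le> ?L (Suc (Suc j))"
    using \<alpha>[of "Suc (Suc j)"] by (simp add: pos_le_divide_eq mult.commute)
  then show ?case
    using IH by simp
qed

text \<open>The eigenvalue \<open>m\<close> is the least \<open>x\<close> at which one of the entries \<open>1, \<dots>, K + 1\<close> of the sequence stops
  being positive. By continuity all entries are still non-negative there. A zero at an entry before the last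
  would make the following entry negative, so the vanishing entry is \<open>K + 1\<close>, which is what makes \<open>m\<close> an
  eigenvalue.\<close>

lemma left_perron:
  fixes s \<alpha> \<beta> \<kappa> :: "nat \<Rightarrow> real"
  assumes "1 \<le> K"
    and \<alpha>: "\<And>i. 0 < \<alpha> i"
    and \<beta>: "\<And>i. 1 \<le> i \<Longrightarrow> i < K \<Longrightarrow> 0 < \<beta> i"
    and \<kappa>: "\<And>i. 1 \<le> i \<Longrightarrow> i < K \<Longrightarrow> 0 \<le> \<kappa> i"
  obtains m l where "l 0 = 0" "\<And>i. 1 \<le> i \<Longrightarrow> i \<le> K \<Longrightarrow> 0 < l i" "\<And>i. K < i \<Longrightarrow> l i = 0"
    "\<And>j. j < K \<Longrightarrow> (s (Suc j) - m) * l (Suc j)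
        = \<alpha> (Suc (Suc j)) * l (Suc (Suc j)) + \<beta> j * l j + \<kappa> (j - 1) * l (j - 1)"
proof -
  define L where "L x = left_seq s \<alpha> \<beta> \<kappa> x" for x
  have L1: "L x 0 = 0" "L x (Suc 0) = 1" for x
    by (simp_all add: L_def)
  have rec: "\<alpha> (Suc (Suc j)) * L x (Suc (Suc j))
      = (s (Suc j) - x) * L x (Suc j) - \<beta> j * L x j - \<kappa> (j - 1) * L x (j - 1)" for x j
    using \<alpha>[of "Suc (Suc j)"] by (simp add: L_def)
  \<comment> \<open>One less than the bound of \<open>left_seq_pos_below\<close>, and the right end \<open>s 1\<close> below is a zero of entry 2.\<close>
  define x0 where "x0 = Min ((\<lambda>j. s (Suc j) - \<alpha> (Suc (Suc j)) - \<bar>\<beta> j\<bar> - \<bar>\<kappa> (j - 1)\<bar>) ` {..<K}) - 1"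
  have below: "x0 + 1 \<le> s (Suc j) - \<alpha> (Suc (Suc j)) - \<bar>\<beta> j\<bar> - \<bar>\<kappa> (j - 1)\<bar>" if "j < K" for j
    unfolding x0_def using that by auto
  define Z where "Z = {x0..s 1} \<inter> (\<Union>j\<in>{..K}. {x. L x (Suc j) \<le> 0})"
  have "x0 \<le> s 1"
    using below[of 0] \<open>1 \<le> K\<close> \<alpha>[of 2] by (simp add: numeral_2_eq_2)
  moreover have "L (s 1) (Suc (Suc 0)) = 0"
    by (simp add: L_def)
  ultimately have "s 1 \<in> Z"
    unfolding Z_def using \<open>1 \<le> K\<close> by (auto intro!: bexI[of _ 1])
  have "closed {x. L x (Suc j) \<le> 0}" for j
    unfolding L_def by (intro closed_Collect_le continuous_left_seq continuous_on_const)
  then have "compact Z"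
    unfolding Z_def by (intro compact_Int_closed closed_UN) auto
  with \<open>s 1 \<in> Z\<close> obtain m where m: "m \<in> Z" "\<And>x. x \<in> Z \<Longrightarrow> m \<le> x"
    using compact_attains_inf[of Z] by blast
  have "x0 \<notin> Z"
  proof -
    have "0 < L x0 (Suc j)" if "j \<le> K" for j
    proof -
      have "x0 \<le> s (Suc i) - \<alpha> (Suc (Suc i)) - \<bar>\<beta> i\<bar> - \<bar>\<kappa> (i - 1)\<bar>" if "i < K" for i
        using below[OF that] by simp
      then show ?thesis
        unfolding L_def using left_seq_pos_below[of \<alpha> K x0 s \<beta> \<kappa> j] \<alpha> \<open>j \<le> K\<close> by blast
    qed
    then show ?thesis
      by (auto simp: Z_def not_le[symmetric])
  qed
  then have "x0 < m"
    using m(1) by (cases "x0 = m") (auto simp: Z_def)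
  have pos: "0 < L x (Suc j)" if "x < m" "x0 \<le> x" "j \<le> K" for x j
  proof (rule ccontr)
    assume "\<not> 0 < L x (Suc j)"
    moreover have "x \<le> s 1" using m(1) that by (simp add: Z_def)
    ultimately have "x \<in> Z"
      using that by (auto simp: Z_def not_less)
    then show False using m(2)[of x] that by simp
  qed
  have nonneg: "0 \<le> L m (Suc j)" if "j \<le> K" for j
  proof (rule tendsto_lowerbound)
    show "((\<lambda>x. L x (Suc j)) \<longlongrightarrow> L m (Suc j)) (at_left m)"
    proof (rule tendsto_within_subset[OF isContD subset_UNIV])
      show "isCont (\<lambda>x. L x (Suc j)) m"
        using continuous_left_seq[of UNIV s \<alpha> \<beta> \<kappa> "Suc j"]
        by (simp add: continuous_on_eq_continuous_at L_def)
    qed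
    show "\<forall>\<^sub>F x in at_left m. 0 \<le> L x (Suc j)"
      unfolding eventually_at_left_field using \<open>x0 < m\<close> pos[OF _ _ that]
      by (intro exI[of _ x0]) (auto intro: less_imp_le)
  qed simp
  have last: "j = K" if "L m (Suc j) = 0" "j \<le> K" for j
  proof (rule ccontr)
    assume "j \<noteq> K"
    define i where "i = (LEAST i. L m (Suc i) = 0)"
    have i: "L m (Suc i) = 0" "i \<le> j"
      unfolding i_def using that(1) by (auto intro: LeastI Least_le)
    then have "i \<noteq> 0" "i < K"
      using L1(2)[of m] that \<open>j \<noteq> K\<close> by (auto intro: gr0I)
    then obtain r where r: "i = Suc r" by (cases i) auto
    have "L m (Suc r) \<noteq> 0"
      using not_less_Least[of r "\<lambda>i. L m (Suc i) = 0"] r by (auto simp: i_def)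
    then have "0 < L m i"
      using nonneg[of r] \<open>i < K\<close> r by simp
    moreover have "0 \<le> \<kappa> (i - 1) * L m (i - 1)"
      using \<kappa>[of "i - 1"] nonneg[of "i - 2"] L1(1)[of m] \<open>i < K\<close> r by (cases r) auto
    moreover have "0 \<le> L m (Suc (Suc i))"
      using nonneg[of "Suc i"] \<open>i < K\<close> by simp
    moreover have "0 < \<beta> i * L m i"
      using \<beta>[of i] \<open>0 < L m i\<close> \<open>i < K\<close> \<open>i \<noteq> 0\<close> by simp
    moreover have "0 \<le> \<alpha> (Suc (Suc i)) * L m (Suc (Suc i))"
      using \<alpha>[of "Suc (Suc i)"] \<open>0 \<le> L m (Suc (Suc i))\<close> by simp
    ultimately show False
      using rec[of i m] i(1) by simp
  qed
  obtain j where "j \<le> K" "L m (Suc j) \<le> 0"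
    using m(1) by (auto simp: Z_def)
  then have K0: "L m (Suc K) = 0"
    using nonneg[of j] last[of j] by simp
  have Lpos: "0 < L m i" if "1 \<le> i" "i \<le> K" for i
    using nonneg[of "i - 1"] last[of "i - 1"] that by (cases i) (auto simp: less_le)
  define l where "l i = (if i \<le> K then L m i else 0)" for i
  have lL: "l i = L m i" if "i \<le> Suc K" for i
    using that K0 by (auto simp: l_def le_Suc_eq)
  show thesis
  proof (rule that[of l m])
    show "l 0 = 0" by (simp add: l_def L1)
    show "0 < l i" if "1 \<le> i" "i \<le> K" for i
      using Lpos that by (simp add: l_def)
    show "l i = 0" if "K < i" for i
      using that by (simp add: l_def)
    show "(s (Suc j) - m) * l (Suc j)
        = \<alpha> (Suc (Suc j)) * l (Suc (Suc j)) + \<beta> j * l j + \<kappa> (j - 1) * l (j - 1)" if "j < K" for j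
      using rec[of j m] that by (simp add: lL)
  qed
qed

text \<open>Given the left vector \<open>l\<close>, a right eigenvector \<open>w\<close> is the same as a stationary distribution
  \<open>l w\<close>, and stationarity amounts to zero net flow through every cut. These cut equations express \<open>w\<close> at one
  index by positive combinations of its values at the next two, so downward recursion keeps \<open>w\<close>
  positive.\<close>

lemma right_from_cut:
  fixes l \<alpha> \<beta> \<kappa> :: "nat \<Rightarrow> real"
  assumes "1 \<le> K"
    and l_pos: "\<And>i. 1 \<le> i \<Longrightarrow> i \<le> K \<Longrightarrow> 0 < l i" and "l 0 = 0"
    and \<alpha>: "\<And>i. 0 < \<alpha> i"
    and \<beta>: "\<And>i. 1 \<le> i \<Longrightarrow> i < K \<Longrightarrow> 0 < \<beta> i"
    and \<kappa>: "\<And>i. 1 \<le> i \<Longrightarrow> i < K \<Longrightarrow> 0 \<le> \<kappa> i"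
  obtains w where "w 0 = 0" "\<And>i. 1 \<le> i \<Longrightarrow> i \<le> K \<Longrightarrow> 0 < w i" "\<And>i. K < i \<Longrightarrow> w i = 0"
    "\<And>i. Suc i < K \<Longrightarrow> l (Suc (Suc i)) * \<alpha> (Suc (Suc i)) * w (Suc i)
        = l (Suc i) * \<beta> (Suc i) * w (Suc (Suc i)) + l (Suc i) * \<kappa> (Suc i) * w (Suc (Suc (Suc i)))
          + l i * \<kappa> i * w (Suc (Suc i))"
proof -
  let ?cut = "\<lambda>w i. l (Suc (Suc i)) * \<alpha> (Suc (Suc i)) * w (Suc i)
        = l (Suc i) * \<beta> (Suc i) * w (Suc (Suc i)) + l (Suc i) * \<kappa> (Suc i) * w (Suc (Suc (Suc i)))
          + l i * \<kappa> i * w (Suc (Suc i))"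
  have "\<exists>w. (\<forall>i. K - d \<le> i \<and> i \<le> K \<longrightarrow> 0 < w i) \<and> (\<forall>i. K < i \<longrightarrow> w i = 0)
      \<and> (\<forall>i. K - d \<le> Suc i \<and> Suc i < K \<longrightarrow> ?cut w i)" if "d < K" for d
    using that
  proof (induction d)
    case 0
    show ?case by (intro exI[of _ "\<lambda>i. if i = K then 1 else 0"]) auto
  next
    case (Suc d)
    then obtain w where w: "\<And>i. K - d \<le> i \<Longrightarrow> i \<le> K \<Longrightarrow> 0 < w i" "\<And>i. K < i \<Longrightarrow> w i = 0"
      "\<And>i. K - d \<le> Suc i \<Longrightarrow> Suc i < K \<Longrightarrow> ?cut w i"
      by auto
    obtain r where r: "K - Suc d = Suc r" "K - d = Suc (Suc r)"
      using Suc.prems by (metis Suc_diff_Suc Suc_lessD)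
    then have rK: "Suc (Suc r) \<le> K" by linarith
    define y where "y = (l (Suc r) * \<beta> (Suc r) * w (Suc (Suc r)) + l (Suc r) * \<kappa> (Suc r) * w (Suc (Suc (Suc r)))
          + l r * \<kappa> r * w (Suc (Suc r))) / (l (Suc (Suc r)) * \<alpha> (Suc (Suc r)))"
    have den: "0 < l (Suc (Suc r)) * \<alpha> (Suc (Suc r))"
      using l_pos \<alpha> rK by simp
    have "0 < l (Suc r) * \<beta> (Suc r) * w (Suc (Suc r))"
      using l_pos \<beta> w(1) r rK by simp
    moreover have "0 \<le> w (Suc (Suc (Suc r)))"
      using w(1)[of "Suc (Suc (Suc r))"] w(2)[of "Suc (Suc (Suc r))"] r
      by (cases "Suc (Suc (Suc r)) \<le> K") auto
    then have "0 \<le> l (Suc r) * \<kappa> (Suc r) * w (Suc (Suc (Suc r)))"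
      using l_pos[of "Suc r"] \<kappa>[of "Suc r"] rK by simp
    moreover have "0 \<le> l r * \<kappa> r * w (Suc (Suc r))"
      using l_pos[of r] \<kappa>[of r] w(1)[of "Suc (Suc r)"] r rK \<open>l 0 = 0\<close> by (cases r) auto
    ultimately have "0 < y"
      unfolding y_def using den by (intro divide_pos_pos) linarith+
    have cut: "l (Suc (Suc r)) * \<alpha> (Suc (Suc r)) * y = l (Suc r) * \<beta> (Suc r) * w (Suc (Suc r))
        + l (Suc r) * \<kappa> (Suc r) * w (Suc (Suc (Suc r))) + l r * \<kappa> r * w (Suc (Suc r))"
    proof -
      have "l (Suc (Suc r)) * \<alpha> (Suc (Suc r)) \<noteq> 0" using den by linarith
      then show ?thesis
        unfolding y_def times_divide_eq_right by (rule nonzero_mult_div_cancel_left)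
    qed
    show ?case
    proof (intro exI[of _ "w(Suc r := y)"] conjI allI impI)
      fix i
      show "0 < (w(Suc r := y)) i" if "K - Suc d \<le> i \<and> i \<le> K"
        using that w(1)[of i] r \<open>0 < y\<close> by auto
      show "(w(Suc r := y)) i = 0" if "K < i"
        using that w(2) rK by auto
      show "?cut (w(Suc r := y)) i" if "K - Suc d \<le> Suc i \<and> Suc i < K"
        using that w(3)[of i] cut r by (cases "i = r") auto
    qed
  qed
  from this[of "K - 1"] \<open>1 \<le> K\<close> obtain w where
    w: "\<And>i. 1 \<le> i \<Longrightarrow> i \<le> K \<Longrightarrow> 0 < w i" "\<And>i. K < i \<Longrightarrow> w i = 0" "\<And>i. Suc i < K \<Longrightarrow> ?cut w i"
    by auto
  show thesis
    by (rule that[of "w(0 := 0)"]) (use w in auto)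
qed

text \<open>Row \<open>i\<close> of the right eigenvector equation, multiplied by \<open>l i\<close>, is the sum of column \<open>i\<close> of the left
  equation and the two cut equations next to \<open>i\<close>.\<close>

lemma perron_pair:
  fixes s \<alpha> \<beta> \<kappa> :: "nat \<Rightarrow> real"
  assumes K: "1 \<le> K"
    and \<alpha>: "\<And>i. 0 < \<alpha> i"
    and \<beta>: "\<And>i. 1 \<le> i \<Longrightarrow> i < K \<Longrightarrow> 0 < \<beta> i"
    and \<kappa>: "\<And>i. 1 \<le> i \<Longrightarrow> i < K \<Longrightarrow> 0 \<le> \<kappa> i"
  obtains m l w where "l 0 = 0" "\<And>i. 1 \<le> i \<Longrightarrow> i \<le> K \<Longrightarrow> 0 < l i" "\<And>i. K < i \<Longrightarrow> l i = 0"
    "w 0 = 0" "\<And>i. 1 \<le> i \<Longrightarrow> i \<le> K \<Longrightarrow> 0 < w i" "\<And>i. K < i \<Longrightarrow> w i = 0"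
    "\<And>i. i < K \<Longrightarrow> (s (Suc i) - m) * w (Suc i)
        = \<alpha> (Suc i) * w i + \<beta> (Suc i) * w (Suc (Suc i)) + \<kappa> (Suc i) * w (Suc (Suc (Suc i)))"
    "\<And>i. Suc i < K \<Longrightarrow> l (Suc (Suc i)) * \<alpha> (Suc (Suc i)) * w (Suc i)
        = l (Suc i) * \<beta> (Suc i) * w (Suc (Suc i)) + l (Suc i) * \<kappa> (Suc i) * w (Suc (Suc (Suc i)))
          + l i * \<kappa> i * w (Suc (Suc i))"
proof (rule left_perron[where s = s and K = K and \<alpha> = \<alpha> and \<beta> = \<beta> and \<kappa> = \<kappa>, OF K \<alpha> \<beta> \<kappa>])
  fix m l
  assume l: "l 0 = 0" "\<And>i. 1 \<le> i \<Longrightarrow> i \<le> K \<Longrightarrow> 0 < l i" "\<And>i. K < i \<Longrightarrow> l i = 0"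
    "\<And>j. j < K \<Longrightarrow> (s (Suc j) - m) * l (Suc j)
        = \<alpha> (Suc (Suc j)) * l (Suc (Suc j)) + \<beta> j * l j + \<kappa> (j - 1) * l (j - 1)"
  show thesis
  proof (rule right_from_cut[where l = l and K = K and \<alpha> = \<alpha> and \<beta> = \<beta> and \<kappa> = \<kappa>, OF K l(2) l(1) \<alpha> \<beta> \<kappa>])
    fix w
    assume w: "w 0 = 0" "\<And>i. 1 \<le> i \<Longrightarrow> i \<le> K \<Longrightarrow> 0 < w i" "\<And>i. K < i \<Longrightarrow> w i = 0"
    "\<And>i. Suc i < K \<Longrightarrow> l (Suc (Suc i)) * \<alpha> (Suc (Suc i)) * w (Suc i)
        = l (Suc i) * \<beta> (Suc i) * w (Suc (Suc i)) + l (Suc i) * \<kappa> (Suc i) * w (Suc (Suc (Suc i)))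
          + l i * \<kappa> i * w (Suc (Suc i))"
  have cut: "l (Suc i) * \<alpha> (Suc i) * w i
        = l i * \<beta> i * w (Suc i) + l i * \<kappa> i * w (Suc (Suc i)) + l (i - 1) * \<kappa> (i - 1) * w (Suc i)"
    if "i \<le> K" for i
  proof (cases i)
    case 0
    then show ?thesis by (simp add: l(1) w(1))
  next
    case (Suc j)
    show ?thesis
    proof (cases "i < K")
      case True
      then show ?thesis using w(4)[of j] Suc by simp
    next
      case False
      then show ?thesis using that by (simp add: l(3) w(3))
    qed
  qed
  show thesis
  proof (rule that[of l w m, OF l(1-3) w(1-3) _ w(4)])
    fix i assume i: "i < K"
    have "l (Suc i) * ((s (Suc i) - m) * w (Suc i))
      = l (Suc i) * (\<alpha> (Suc i) * w i + \<beta> (Suc i) * w (Suc (Suc i)) + \<kappa> (Suc i) * w (Suc (Suc (Suc i))))"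
    proof -
      have "l (Suc i) * ((s (Suc i) - m) * w (Suc i)) = ((s (Suc i) - m) * l (Suc i)) * w (Suc i)"
        by simp
      also have "\<dots> = l (Suc (Suc i)) * \<alpha> (Suc (Suc i)) * w (Suc i) + l i * \<beta> i * w (Suc i)
          + l (i - 1) * \<kappa> (i - 1) * w (Suc i)"
        unfolding l(4)[OF i] by (simp add: algebra_simps)
      also have "\<dots> = l (Suc i) * (\<alpha> (Suc i) * w i + \<beta> (Suc i) * w (Suc (Suc i))
          + \<kappa> (Suc i) * w (Suc (Suc (Suc i))))"
        using cut[of i] cut[of "Suc i"] i by (simp add: algebra_simps)
      finally show ?thesis .
    qed
    then show "(s (Suc i) - m) * w (Suc i)
        = \<alpha> (Suc i) * w i + \<beta> (Suc i) * w (Suc (Suc i)) + \<kappa> (Suc i) * w (Suc (Suc (Suc i)))"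
      using l(2)[of "Suc i"] i by simp
  qed
  qed
qed

section \<open>Tridiagonal matrices with unit row sums\<close>

definition band_apply ::
    "(nat \<Rightarrow> real) \<Rightarrow> (nat \<Rightarrow> real) \<Rightarrow> (nat \<Rightarrow> real) \<Rightarrow> (nat \<Rightarrow> complex) \<Rightarrow> nat \<Rightarrow> complex" where
  "band_apply a b c v i = of_real (c i) * v (i - 1) + of_real (a i) * v i + of_real (b i) * v (Suc i)"

text \<open>The interior of the collocation matrix: rows \<open>1, \<dots>, K\<close> between two boundary rows \<open>0\<close> and
  \<open>K + 1\<close>, with diagonals \<open>c\<close>, \<open>a\<close>, \<open>b\<close>. The weights \<open>\<delta>\<close> make the matrix symmetric with off-diagonal entries
  \<open>e\<close>. The values \<open>e 0\<close> and \<open>e K\<close> belong to the edges to the boundary, where vectors vanish; including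
  them gives all rows the same form.\<close>

locale tridiagonal =
  fixes K :: nat and a b c \<delta> e :: "nat \<Rightarrow> real"
  assumes \<delta>_pos: "\<And>i. i < K \<Longrightarrow> 0 < \<delta> (Suc i)"
    and e_pos: "\<And>i. i \<le> K \<Longrightarrow> 0 < e i"
    and upper: "\<And>i. i < K \<Longrightarrow> \<delta> (Suc i) * b (Suc i) = e (Suc i)"
    and lower: "\<And>i. i < K \<Longrightarrow> \<delta> (Suc i) * c (Suc i) = e i"
    and a_nonneg: "\<And>i. i < K \<Longrightarrow> 0 \<le> a (Suc i)"
    and row_sum: "\<And>i. i < K \<Longrightarrow> a (Suc i) + b (Suc i) + c (Suc i) = 1"
    and last_row: "a (Suc K) = 1" "b (Suc K) = 0" "c (Suc K) = 0"
begin

text \<open>The sesquilinear form \<open>\<langle>f, B g\<rangle>\<close> for the inner product with weights \<open>\<delta>\<close>; \<open>bform_mult\<close> makes this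
  precise.\<close>

definition bform :: "(nat \<Rightarrow> complex) \<Rightarrow> (nat \<Rightarrow> complex) \<Rightarrow> complex" where
  "bform f g = (\<Sum>i<K. of_real (\<delta> (Suc i) * a (Suc i)) * (cnj (f (Suc i)) * g (Suc i)))
     + (\<Sum>i<Suc K. of_real (e i) * (cnj (f i) * g (Suc i) + cnj (f (Suc i)) * g i))"

abbreviation mult :: "(nat \<Rightarrow> complex) \<Rightarrow> nat \<Rightarrow> complex" where
  "mult \<equiv> band_apply a b c"

lemma bform_diff: "bform (\<lambda>i. f i - g i) (\<lambda>i. f i - g i) = bform f f + bform g g - bform f g - bform g f"
  unfolding bform_def by (simp add: sum.distrib sum_subtractf sum_distrib_left algebra_simps)

lemma bform_commute: "bform g f = cnj (bform f g)"
  unfolding bform_def by (simp add: mult.commute add.commute)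

lemma bform_self_real: "Im (bform f f) = 0"
  using bform_commute[of f f] by (metis complex_cnj_zero_iff cnj.sel(2) equal_neg_zero)

lemma bform_mult:
  assumes f: "f 0 = 0" "f (Suc K) = 0"
  shows "(\<Sum>i<K. of_real (\<delta> (Suc i)) * (cnj (f (Suc i)) * mult v (Suc i))) = bform f v"
proof -
  have "(\<Sum>i<K. of_real (\<delta> (Suc i)) * (cnj (f (Suc i)) * mult v (Suc i)))
    = (\<Sum>i<K. of_real (\<delta> (Suc i) * a (Suc i)) * (cnj (f (Suc i)) * v (Suc i))
        + of_real (e i) * (cnj (f (Suc i)) * v i)
        + of_real (e (Suc i)) * (cnj (f (Suc i)) * v (Suc (Suc i))))"
  proof (intro sum.cong refl)
    fix i assume "i \<in> {..<K}"
    then have i: "i < K" by simp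
    show "of_real (\<delta> (Suc i)) * (cnj (f (Suc i)) * mult v (Suc i))
      = of_real (\<delta> (Suc i) * a (Suc i)) * (cnj (f (Suc i)) * v (Suc i))
        + of_real (e i) * (cnj (f (Suc i)) * v i)
        + of_real (e (Suc i)) * (cnj (f (Suc i)) * v (Suc (Suc i)))"
      unfolding upper[OF i, symmetric] lower[OF i, symmetric] band_apply_def
      by (simp add: algebra_simps)
  qed
  also have "\<dots> = (\<Sum>i<K. of_real (\<delta> (Suc i) * a (Suc i)) * (cnj (f (Suc i)) * v (Suc i)))
      + (\<Sum>i<K. of_real (e i) * (cnj (f (Suc i)) * v i))
      + (\<Sum>i<K. of_real (e (Suc i)) * (cnj (f (Suc i)) * v (Suc (Suc i))))"
    by (simp only: sum.distrib)
  also have "(\<Sum>i<K. of_real (e (Suc i)) * (cnj (f (Suc i)) * v (Suc (Suc i))))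
      = (\<Sum>i<Suc K. of_real (e i) * (cnj (f i) * v (Suc i)))"
    by (subst sum.lessThan_Suc_shift) (simp add: f)
  also have "(\<Sum>i<K. of_real (e i) * (cnj (f (Suc i)) * v i))
      = (\<Sum>i<Suc K. of_real (e i) * (cnj (f (Suc i)) * v i))"
    by (simp add: f)
  finally show ?thesis
    by (simp only: bform_def distrib_left sum.distrib add_ac)
qed

lemma Re_bform_self:
  "Re (bform w w) = (\<Sum>i<K. \<delta> (Suc i) * a (Suc i) * (cmod (w (Suc i)))\<^sup>2)
     + 2 * Re (\<Sum>i<Suc K. of_real (e i) * (cnj (w i) * w (Suc i)))"
proof -
  have "Re (of_real r * (cnj x * x)) = r * (cmod x)\<^sup>2" for r x
    by (simp add: cmod_power2) (simp add: power2_eq_square algebra_simps)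
  moreover have "Re (of_real r * (cnj x * y + cnj y * x)) = 2 * Re (of_real r * (cnj x * y))" for r x y
    by (simp add: algebra_simps)
  ultimately show ?thesis
    unfolding bform_def by (simp only: Re_sum plus_complex.sel sum_distrib_left)
qed

text \<open>Row sums 1 mean that \<open>\<delta> (1 - a)\<close> at an index is the sum of the weights \<open>e\<close> of its two edges, so
  \<open>W\<close> exceeds the diagonal part of the form by the sum of \<open>e (\<bar>w i\<bar>\<^sup>2 + \<bar>w (i + 1)\<bar>\<^sup>2)\<close>, which dominates
  \<open>2 \<bar>\<sigma>\<bar>\<close> edge by edge.\<close>

lemma bform_self_le:
  assumes w: "w 0 = 0" "w (Suc K) = 0"
  defines "W \<equiv> (\<Sum>i<K. \<delta> (Suc i) * (cmod (w (Suc i)))\<^sup>2)"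
    and "\<sigma> \<equiv> (\<Sum>i<Suc K. of_real (e i) * (cnj (w i) * w (Suc i)))"
  shows "Re (bform w w) \<le> W - 2 * cmod \<sigma> + 2 * Re \<sigma>" and "2 * cmod \<sigma> \<le> W"
proof -
  define D where "D = (\<Sum>i<K. \<delta> (Suc i) * a (Suc i) * (cmod (w (Suc i)))\<^sup>2)"
  have Re: "Re (bform w w) = D + 2 * Re \<sigma>"
    unfolding Re_bform_self D_def \<sigma>_def ..
  have "W - D = (\<Sum>i<K. (e i + e (Suc i)) * (cmod (w (Suc i)))\<^sup>2)"
    unfolding W_def D_def sum_subtractf[symmetric]
  proof (intro sum.cong refl)
    fix i assume "i \<in> {..<K}"
    then have i: "i < K" by simp
    have "\<delta> (Suc i) * (1 - a (Suc i)) = e i + e (Suc i)"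
      unfolding upper[OF i, symmetric] lower[OF i, symmetric] row_sum[OF i, symmetric]
      by (simp add: algebra_simps)
    then show "\<delta> (Suc i) * (cmod (w (Suc i)))\<^sup>2 - \<delta> (Suc i) * a (Suc i) * (cmod (w (Suc i)))\<^sup>2
        = (e i + e (Suc i)) * (cmod (w (Suc i)))\<^sup>2"
      by (metis left_diff_distrib mult.right_neutral right_diff_distrib)
  qed
  also have "\<dots> = (\<Sum>i<K. e i * (cmod (w (Suc i)))\<^sup>2) + (\<Sum>i<K. e (Suc i) * (cmod (w (Suc i)))\<^sup>2)"
    by (simp only: distrib_right sum.distrib)
  also have "(\<Sum>i<K. e i * (cmod (w (Suc i)))\<^sup>2) = (\<Sum>i<Suc K. e i * (cmod (w (Suc i)))\<^sup>2)"
    by (simp add: w)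
  also have "(\<Sum>i<K. e (Suc i) * (cmod (w (Suc i)))\<^sup>2) = (\<Sum>i<Suc K. e i * (cmod (w i))\<^sup>2)"
    by (subst sum.lessThan_Suc_shift) (simp add: w)
  also have "(\<Sum>i<Suc K. e i * (cmod (w (Suc i)))\<^sup>2) + (\<Sum>i<Suc K. e i * (cmod (w i))\<^sup>2)
      \<ge> (\<Sum>i<Suc K. 2 * cmod (of_real (e i) * (cnj (w i) * w (Suc i))))"
    unfolding sum.distrib[symmetric]
  proof (intro sum_mono)
    fix i assume "i \<in> {..<Suc K}"
    then have "0 < e i" using e_pos by simp
    moreover have "2 * (cmod (w i) * cmod (w (Suc i))) \<le> (cmod (w (Suc i)))\<^sup>2 + (cmod (w i))\<^sup>2"
      using sum_squares_bound[of "cmod (w i)" "cmod (w (Suc i))"] by simp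
    ultimately have "e i * (2 * (cmod (w i) * cmod (w (Suc i)))) \<le> e i * ((cmod (w (Suc i)))\<^sup>2 + (cmod (w i))\<^sup>2)"
      by (intro mult_left_mono) auto
    then show "2 * cmod (of_real (e i) * (cnj (w i) * w (Suc i)))
        \<le> e i * (cmod (w (Suc i)))\<^sup>2 + e i * (cmod (w i))\<^sup>2"
      using \<open>0 < e i\<close> by (simp add: norm_mult distrib_left)
  qed
  finally have "W - D \<ge> 2 * (\<Sum>i<Suc K. cmod (of_real (e i) * (cnj (w i) * w (Suc i))))"
    by (simp only: sum_distrib_left)
  moreover have "cmod \<sigma> \<le> (\<Sum>i<Suc K. cmod (of_real (e i) * (cnj (w i) * w (Suc i))))"
    unfolding \<sigma>_def by (rule norm_sum)
  ultimately have *: "2 * cmod \<sigma> \<le> W - D" by linarith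
  then show "Re (bform w w) \<le> W - 2 * cmod \<sigma> + 2 * Re \<sigma>"
    unfolding Re by linarith
  have "0 \<le> D"
    unfolding D_def using \<delta>_pos a_nonneg
    by (intro sum_nonneg mult_nonneg_nonneg) (auto intro: less_imp_le)
  with * show "2 * cmod \<sigma> \<le> W" by linarith
qed

text \<open>Each diagonal entry is shared between the two edges at its index, \<open>\<xi>\<close> to the edge above and
  \<open>\<eta>\<close> to the edge below. If every edge receives enough for its \<open>2 \<times> 2\<close> form to be non-negative and something
  is left over at each index, the form is positive definite.\<close>

lemma bform_pos_by_weights:
  assumes \<xi>: "\<And>i. 1 \<le> i \<Longrightarrow> i \<le> K \<Longrightarrow> 0 \<le> \<xi> i" and \<eta>: "\<And>i. i < K \<Longrightarrow> 0 \<le> \<eta> i"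
    and prod: "\<And>i. 1 \<le> i \<Longrightarrow> i < K \<Longrightarrow> (e i)\<^sup>2 \<le> \<xi> i * \<eta> i"
    and diag: "\<And>i. i < K \<Longrightarrow> \<xi> (Suc i) + \<eta> i < \<delta> (Suc i) * a (Suc i)"
    and f: "f 0 = 0" "f (Suc K) = 0" and nz: "\<exists>i<K. f (Suc i) \<noteq> 0"
  shows "0 < Re (bform f f)"
proof -
  define h where "h i = (cmod (f i))\<^sup>2" for i
  have h: "h 0 = 0" "h (Suc K) = 0" "0 \<le> h i" for i
    by (simp_all add: h_def f)
  have edge: "- 2 * Re (of_real (e i) * (cnj (f i) * f (Suc i))) \<le> \<xi> i * h i + \<eta> i * h (Suc i)"
    if i: "i < Suc K" for i
  proof -
    consider "i = 0" | "i = K" | "1 \<le> i" "i < K"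
      using i by (metis less_SucE less_one not_le)
    then show ?thesis
    proof cases
      case 1
      then show ?thesis using \<eta>[of 0] h f by (cases "K = 0") auto
    next
      case 2
      then show ?thesis using \<xi>[of K] h f by (cases "K = 0") auto
    next
      case 3
      have "- 2 * Re (of_real (e i) * (cnj (f i) * f (Suc i)))
          \<le> 2 * cmod (of_real (e i) * (cnj (f i) * f (Suc i)))"
        using abs_Re_le_cmod[of "of_real (e i) * (cnj (f i) * f (Suc i))"] by linarith
      also have "\<dots> = 2 * (e i * (cmod (f i) * cmod (f (Suc i))))"
        using e_pos[of i] 3 by (simp add: norm_mult)
      also have "\<dots> \<le> 2 * (sqrt (\<xi> i) * cmod (f i)) * (sqrt (\<eta> i) * cmod (f (Suc i)))"
      proof -
        have "e i \<le> sqrt (\<xi> i * \<eta> i)"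
          using prod[OF 3] by (rule real_le_rsqrt)
        then have "e i * (cmod (f i) * cmod (f (Suc i))) \<le> sqrt (\<xi> i * \<eta> i) * (cmod (f i) * cmod (f (Suc i)))"
          by (rule mult_right_mono) simp
        then show ?thesis by (simp add: real_sqrt_mult mult_ac)
      qed
      also have "\<dots> \<le> (sqrt (\<xi> i) * cmod (f i))\<^sup>2 + (sqrt (\<eta> i) * cmod (f (Suc i)))\<^sup>2"
        by (rule sum_squares_bound)
      also have "\<dots> = \<xi> i * h i + \<eta> i * h (Suc i)"
        using \<xi>[of i] \<eta>[of i] 3 by (simp add: power_mult_distrib h_def)
      finally show ?thesis .
    qed
  qed
  have "- 2 * Re (\<Sum>i<Suc K. of_real (e i) * (cnj (f i) * f (Suc i)))
      = (\<Sum>i<Suc K. - 2 * Re (of_real (e i) * (cnj (f i) * f (Suc i))))"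
    unfolding Re_sum sum_distrib_left ..
  also have "\<dots> \<le> (\<Sum>i<Suc K. \<xi> i * h i + \<eta> i * h (Suc i))"
    by (intro sum_mono edge) simp
  also have "\<dots> = (\<Sum>i<Suc K. \<xi> i * h i) + (\<Sum>i<Suc K. \<eta> i * h (Suc i))"
    by (rule sum.distrib)
  also have "(\<Sum>i<Suc K. \<xi> i * h i) = (\<Sum>i<K. \<xi> (Suc i) * h (Suc i))"
    by (subst sum.lessThan_Suc_shift) (simp add: h)
  also have "(\<Sum>i<Suc K. \<eta> i * h (Suc i)) = (\<Sum>i<K. \<eta> i * h (Suc i))"
    by (simp add: h)
  also have "(\<Sum>i<K. \<xi> (Suc i) * h (Suc i)) + (\<Sum>i<K. \<eta> i * h (Suc i))
      = (\<Sum>i<K. (\<xi> (Suc i) + \<eta> i) * h (Suc i))"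
    by (simp only: distrib_right sum.distrib)
  also have "\<dots> < (\<Sum>i<K. \<delta> (Suc i) * a (Suc i) * h (Suc i))"
  proof (rule sum_strict_mono_ex1)
    show "\<forall>i\<in>{..<K}. (\<xi> (Suc i) + \<eta> i) * h (Suc i) \<le> \<delta> (Suc i) * a (Suc i) * h (Suc i)"
      using mult_right_mono[OF less_imp_le[OF diag] h(3)] by simp
    show "\<exists>i\<in>{..<K}. (\<xi> (Suc i) + \<eta> i) * h (Suc i) < \<delta> (Suc i) * a (Suc i) * h (Suc i)"
    proof -
      obtain i where i: "i < K" "f (Suc i) \<noteq> 0" using nz by blast
      then have "0 < h (Suc i)" by (simp add: h_def)
      then show ?thesis
        using mult_strict_right_mono[OF diag[OF i(1)]] i(1) by blast
    qed
  qed simp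
  finally show ?thesis
    unfolding Re_bform_self h_def by linarith
qed

end

locale positive_tridiagonal = tridiagonal +
  assumes bform_pos: "\<And>f. f 0 = 0 \<Longrightarrow> f (Suc K) = 0 \<Longrightarrow> (\<exists>i<K. f (Suc i) \<noteq> 0) \<Longrightarrow> 0 < Re (bform f f)"
begin

lemma bform_nonneg:
  assumes "f 0 = 0" "f (Suc K) = 0"
  shows "0 \<le> Re (bform f f)"
proof (cases "\<exists>i<K. f (Suc i) \<noteq> 0")
  case True
  then show ?thesis using bform_pos assms by force
next
  case False
  then have "f (Suc i) = 0" if "i < Suc K" for i
    using that assms(2) by (auto simp: less_Suc_eq)
  moreover from this have "f i = 0" if "i < Suc K" for i
    using that assms(1) by (cases i) auto
  ultimately have "bform f f = 0"
    by (simp add: bform_def)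
  then show ?thesis by simp
qed

text \<open>With \<open>P = \<langle>v, B v\<rangle>\<close>, \<open>w = B v\<close> and \<open>W = \<langle>w, w\<rangle>\<close>, pairing the eigenvalue equation with \<open>w\<close> gives
  \<open>z P = W - \<sigma>\<close>, hence \<open>P (1 - z) = (P - W) + \<sigma>\<close>. The form at \<open>v - w\<close> is \<open>P - 2 W + \<langle>w, B w\<rangle> \<ge> 0\<close>, and
  \<open>bform_self_le\<close> bounds \<open>\<langle>w, B w\<rangle>\<close>, so \<open>P - W + Re \<sigma> \<ge> 2 \<bar>\<sigma>\<bar> - Re \<sigma> \<ge> \<surd>3 \<bar>Im \<sigma>\<bar>\<close>.
  Moreover \<open>2 \<bar>\<sigma>\<bar> \<le> W\<close>, so the real part of \<open>z P\<close> is at least \<open>W / 2 > 0\<close>.\<close>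

lemma eigenvalue_bound_above:
  fixes v :: "nat \<Rightarrow> complex"
  assumes v: "v 0 = 0" "v (Suc K) = 0" and nz: "\<exists>i<K. v (Suc i) \<noteq> 0"
    and eig: "\<And>i. i < K \<Longrightarrow> z * v (Suc i) = mult v (Suc i) - of_real (b (Suc i)) * mult v (Suc (Suc i))"
  shows "sector (1 - z)" and "0 < Re z"
proof -
  define w where "w i = (if i = 0 then 0 else mult v i)" for i
  have w: "w 0 = 0" "w (Suc K) = 0"
    using last_row v by (simp_all add: w_def band_apply_def)
  define W where "W = (\<Sum>i<K. \<delta> (Suc i) * (cmod (w (Suc i)))\<^sup>2)"
  define \<sigma> where "\<sigma> = (\<Sum>i<Suc K. of_real (e i) * (cnj (w i) * w (Suc i)))"
  define P where "P = Re (bform v v)"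
  have P: "bform v v = of_real P"
    unfolding P_def by (simp add: complex_eq_iff bform_self_real)
  have "0 < P"
    unfolding P_def by (rule bform_pos[OF v nz])
  have W: "bform w v = of_real W"
  proof -
    have "bform w v = (\<Sum>i<K. of_real (\<delta> (Suc i)) * (cnj (w (Suc i)) * mult v (Suc i)))"
      by (rule bform_mult[symmetric]) (use w in auto)
    also have "\<dots> = of_real W"
      unfolding W_def of_real_sum of_real_mult complex_norm_square
      by (simp add: w_def mult_ac)
    finally show ?thesis .
  qed
  have zP: "z * of_real P = of_real W - \<sigma>"
  proof -
    have "(\<Sum>i<K. of_real (\<delta> (Suc i)) * (cnj (v (Suc i)) * w (Suc i))) = of_real P"
      using bform_mult[OF v, of v] P by (simp add: w_def)
    from arg_cong[OF this, of cnj]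
    have P': "(\<Sum>i<K. of_real (\<delta> (Suc i)) * (cnj (w (Suc i)) * v (Suc i))) = of_real P"
      by (simp add: mult.commute)
    have "z * of_real P = (\<Sum>i<K. of_real (\<delta> (Suc i)) * (cnj (w (Suc i)) * (z * v (Suc i))))"
      unfolding P'[symmetric] sum_distrib_left by (simp only: mult_ac)
    also have "\<dots> = (\<Sum>i<K. of_real (\<delta> (Suc i)) * (cnj (w (Suc i)) * w (Suc i))
        - of_real (e (Suc i)) * (cnj (w (Suc i)) * w (Suc (Suc i))))"
    proof (intro sum.cong refl)
      fix i assume "i \<in> {..<K}"
      then have i: "i < K" by simp
      show "of_real (\<delta> (Suc i)) * (cnj (w (Suc i)) * (z * v (Suc i)))
        = of_real (\<delta> (Suc i)) * (cnj (w (Suc i)) * w (Suc i))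
          - of_real (e (Suc i)) * (cnj (w (Suc i)) * w (Suc (Suc i)))"
        unfolding eig[OF i] upper[OF i, symmetric] by (simp add: w_def algebra_simps)
    qed
    also have "\<dots> = of_real W - (\<Sum>i<K. of_real (e (Suc i)) * (cnj (w (Suc i)) * w (Suc (Suc i))))"
      unfolding sum_subtractf W_def of_real_sum of_real_mult complex_norm_square
      by (simp only: mult_ac)
    also have "(\<Sum>i<K. of_real (e (Suc i)) * (cnj (w (Suc i)) * w (Suc (Suc i)))) = \<sigma>"
      unfolding \<sigma>_def by (subst sum.lessThan_Suc_shift) (simp add: w)
    finally show ?thesis .
  qed
  have Bw: "Re (bform w w) \<le> W - 2 * cmod \<sigma> + 2 * Re \<sigma>"
    unfolding W_def \<sigma>_def by (rule bform_self_le(1)[OF w])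
  have "0 \<le> Re (bform (\<lambda>i. v i - w i) (\<lambda>i. v i - w i))"
    by (rule bform_nonneg) (simp_all add: v w)
  also have "\<dots> = P + Re (bform w w) - 2 * W"
    unfolding bform_diff bform_commute[of v w] by (simp add: W P)
  finally have PW: "2 * cmod \<sigma> - Re \<sigma> \<le> P - W + Re \<sigma>"
    using Bw by simp
  \<comment> \<open>Cauchy-Schwarz for the vectors \<open>(\<surd>3, 1)\<close> and \<open>(\<bar>Im \<sigma>\<bar>, Re \<sigma>)\<close>.\<close>
  have root3: "sqrt 3 * \<bar>Im \<sigma>\<bar> + Re \<sigma> \<le> 2 * cmod \<sigma>"
  proof (rule power2_le_imp_le)
    have "(2 * cmod \<sigma>)\<^sup>2 - (sqrt 3 * \<bar>Im \<sigma>\<bar> + Re \<sigma>)\<^sup>2 = (\<bar>Im \<sigma>\<bar> - sqrt 3 * Re \<sigma>)\<^sup>2"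
      by (simp add: power_mult_distrib cmod_power2 power2_sum power2_diff algebra_simps)
    then show "(sqrt 3 * \<bar>Im \<sigma>\<bar> + Re \<sigma>)\<^sup>2 \<le> (2 * cmod \<sigma>)\<^sup>2"
      using zero_le_power2[of "\<bar>Im \<sigma>\<bar> - sqrt 3 * Re \<sigma>"] by linarith
  qed simp
  have eq: "of_real P * (1 - z) = of_real (P - W) + \<sigma>"
    using zP by (simp add: algebra_simps)
  have "sector (of_real (P - W) + \<sigma>)"
    unfolding sector_def using PW root3 by simp
  then show "sector (1 - z)"
    unfolding eq[symmetric] using \<open>0 < P\<close> sector_scale_iff by blast
  show "0 < Re z"
  proof -
    have "Re z * P = W - Re \<sigma>"
      using arg_cong[OF zP, of Re] by simp
    moreover have "2 * cmod \<sigma> \<le> W"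
      unfolding W_def \<sigma>_def by (rule bform_self_le(2)[OF w])
    moreover have "0 < W"
    proof -
      have "0 \<le> W"
        unfolding W_def using \<delta>_pos by (intro sum_nonneg mult_nonneg_nonneg) (auto intro: less_imp_le)
      moreover have "W \<noteq> 0"
      proof
        assume "W = 0"
        then have "\<forall>i\<in>{..<K}. \<delta> (Suc i) * (cmod (w (Suc i)))\<^sup>2 = 0"
          unfolding W_def
          by (subst (asm) sum_nonneg_eq_0_iff) (auto simp: \<delta>_pos less_imp_le)
        then have w0: "w (Suc i) = 0" if "i < K" for i
          using that \<delta>_pos[OF that] by force
        have "bform v v = 0"
          unfolding bform_mult[OF v, symmetric] using w0 by (simp add: w_def)
        then show False
          using \<open>0 < P\<close> by (simp add: P_def)
      qed
      ultimately show ?thesis by simp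
    qed
    moreover have "Re \<sigma> \<le> cmod \<sigma>"
      by (rule complex_Re_le_cmod)
    ultimately have "0 < Re z * P"
      using norm_ge_zero[of \<sigma>] by linarith
    then show ?thesis
      using \<open>0 < P\<close> by (simp add: zero_less_mult_iff)
  qed
qed

lemma off_diagonal_pos:
  assumes "i < K" shows "0 < b (Suc i)" "0 < c (Suc i)" "a (Suc i) < 1"
proof -
  show b: "0 < b (Suc i)"
    using upper[OF assms] \<delta>_pos[OF assms] e_pos[of "Suc i"] assms by (simp add: zero_less_mult_iff flip: upper)
  show c: "0 < c (Suc i)"
    using lower[OF assms] \<delta>_pos[OF assms] e_pos[of i] assms by (simp add: zero_less_mult_iff flip: lower)
  show "a (Suc i) < 1"
    using row_sum[OF assms] b c by linarith
qed

text \<open>Conjugation with \<open>(-1)\<^sup>i\<close> makes the off-diagonal entries of the interior of \<open>Q B\<close> non-positive: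
  subtracting \<open>b i\<close> times row \<open>i + 1\<close> leaves \<open>b i (1 - a (i + 1)) > 0\<close> on the superdiagonal and creates
  \<open>- b i b (i + 1)\<close> two places off the diagonal, where the conjugation changes no
  sign.\<close>

lemma smallest_eigenvalue:
  assumes "1 \<le> K"
  obtains m :: real and v :: "nat \<Rightarrow> complex" where
    "v 0 = 0" "\<And>i. K < i \<Longrightarrow> v i = 0" "\<exists>i<K. v (Suc i) \<noteq> 0"
    "\<And>i. i < K \<Longrightarrow> of_real m * v (Suc i)
        = mult v (Suc i) - of_real (b (Suc i)) * mult v (Suc (Suc i))"
    "\<And>z v. v 0 = 0 \<Longrightarrow> (\<And>i. K < i \<Longrightarrow> v i = 0) \<Longrightarrow> (\<exists>i<K. v (Suc i) \<noteq> 0) \<Longrightarrow>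
      (\<And>i. i < K \<Longrightarrow> z * v (Suc i) = mult v (Suc i) - of_real (b (Suc i)) * mult v (Suc (Suc i)))
      \<Longrightarrow> sector (z - of_real m)"
proof -
  \<comment> \<open>The value 1 of \<open>\<alpha>\<close> outside the range only serves to make \<open>\<alpha>\<close> positive everywhere.\<close>
  define s \<alpha> \<beta> \<kappa> where "s i = a i - b i * c (Suc i)"
    and "\<alpha> i = (if 1 \<le> i \<and> i \<le> K then c i else 1)"
    and "\<beta> i = b i * (1 - a (Suc i))" and "\<kappa> i = b i * b (Suc i)" for i
  have b: "0 < b i" and c: "0 < c i" and a: "a i < 1" if "1 \<le> i" "i \<le> K" for i
    using off_diagonal_pos[of "i - 1"] that by auto
  have \<alpha>: "0 < \<alpha> i" for i
    using c by (simp add: \<alpha>_def)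
  have \<beta>: "0 < \<beta> i" if "1 \<le> i" "i < K" for i
    using b[of i] a[of "Suc i"] that by (simp add: \<beta>_def)
  have \<kappa>: "0 \<le> \<kappa> i" if "1 \<le> i" "i < K" for i
    using b[of i] b[of "Suc i"] that by (simp add: \<kappa>_def)
  have \<beta>': "0 \<le> \<beta> i" and \<kappa>': "0 \<le> \<kappa> i" if "1 \<le> i" "i \<le> K" for i
    using \<beta>[of i] \<kappa>[of i] that last_row by (auto simp: le_less \<beta>_def \<kappa>_def)
  have row: "mult u (Suc i) - of_real (b (Suc i)) * mult u (Suc (Suc i))
      = of_real (s (Suc i)) * u (Suc i) + of_real (\<alpha> (Suc i)) * u i
        + of_real (\<beta> (Suc i)) * u (Suc (Suc i)) - of_real (\<kappa> (Suc i)) * u (Suc (Suc (Suc i)))"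
    if "i < K" for i u
    using that by (simp add: band_apply_def s_def \<alpha>_def \<beta>_def \<kappa>_def algebra_simps)
  define alt :: "nat \<Rightarrow> complex" where "alt i = (- 1) ^ i" for i
  have alt: "alt (Suc i) = - alt i" "alt i * alt i = 1" "alt i \<noteq> 0" for i
    by (simp_all add: alt_def flip: power_mult_distrib)
  show thesis
  proof (rule perron_pair[where s = s and K = K and \<alpha> = \<alpha> and \<beta> = \<beta> and \<kappa> = \<kappa>, OF assms \<alpha> \<beta> \<kappa>])
    fix m l w
    assume l: "l 0 = 0" "\<And>i. 1 \<le> i \<Longrightarrow> i \<le> K \<Longrightarrow> 0 < l i" "\<And>i. K < i \<Longrightarrow> l i = 0"
      and w: "w 0 = 0" "\<And>i. 1 \<le> i \<Longrightarrow> i \<le> K \<Longrightarrow> 0 < w i" "\<And>i. K < i \<Longrightarrow> w i = 0"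
      and right: "\<And>i. i < K \<Longrightarrow> (s (Suc i) - m) * w (Suc i)
        = \<alpha> (Suc i) * w i + \<beta> (Suc i) * w (Suc (Suc i)) + \<kappa> (Suc i) * w (Suc (Suc (Suc i)))"
      and cut: "\<And>i. Suc i < K \<Longrightarrow> l (Suc (Suc i)) * \<alpha> (Suc (Suc i)) * w (Suc i)
        = l (Suc i) * \<beta> (Suc i) * w (Suc (Suc i)) + l (Suc i) * \<kappa> (Suc i) * w (Suc (Suc (Suc i)))
          + l i * \<kappa> i * w (Suc (Suc i))"
    show thesis
    proof (rule that[of "\<lambda>i. alt i * of_real (w i)" m])
      show "alt 0 * of_real (w 0) = 0" by (simp add: w)
      show "alt i * of_real (w i) = 0" if "K < i" for i using that by (simp add: w)
      show "\<exists>i<K. alt (Suc i) * complex_of_real (w (Suc i)) \<noteq> 0"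
        using w(2)[of 1] assms alt(3) by (intro exI[of _ 0]) auto
      show "of_real m * (alt (Suc i) * of_real (w (Suc i)))
          = mult (\<lambda>i. alt i * of_real (w i)) (Suc i)
            - of_real (b (Suc i)) * mult (\<lambda>i. alt i * of_real (w i)) (Suc (Suc i))" if "i < K" for i
      proof -
        have "m * w (Suc i) = s (Suc i) * w (Suc i) - \<alpha> (Suc i) * w i - \<beta> (Suc i) * w (Suc (Suc i))
            - \<kappa> (Suc i) * w (Suc (Suc (Suc i)))"
          using right[OF that] by (simp add: algebra_simps)
        from arg_cong[OF this, of complex_of_real]
        have "of_real m * of_real (w (Suc i)) = complex_of_real (s (Suc i)) * of_real (w (Suc i))
            - of_real (\<alpha> (Suc i)) * of_real (w i) - of_real (\<beta> (Suc i)) * of_real (w (Suc (Suc i)))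
            - of_real (\<kappa> (Suc i)) * of_real (w (Suc (Suc (Suc i))))"
          by simp
        from arg_cong[OF this, of "\<lambda>x. x * alt (Suc i)"] show ?thesis
          unfolding row[OF that] by (simp add: alt(1) algebra_simps)
      qed
      fix z v
      assume v: "v 0 = 0" "\<And>i. K < i \<Longrightarrow> v i = 0" "\<exists>i<K. v (Suc i) \<noteq> 0"
        and eig: "\<And>i. i < K \<Longrightarrow> z * v (Suc i)
          = mult v (Suc i) - of_real (b (Suc i)) * mult v (Suc (Suc i))"
      obtain j where j: "v (Suc j) \<noteq> 0" using v(3) by blast
      show "sector (z - of_real m)"
      proof (rule dirichlet_sector[where K = K and l = l and w = w and s = s and \<alpha> = \<alpha> and \<beta> = \<beta>
            and \<kappa> = \<kappa> and v = "\<lambda>i. alt i * v i" and j = "Suc j"])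
        show "z * (alt (Suc i) * v (Suc i)) = of_real (s (Suc i)) * (alt (Suc i) * v (Suc i))
            - of_real (\<alpha> (Suc i)) * (alt i * v i) - of_real (\<beta> (Suc i)) * (alt (Suc (Suc i)) * v (Suc (Suc i)))
            - of_real (\<kappa> (Suc i)) * (alt (Suc (Suc (Suc i))) * v (Suc (Suc (Suc i))))" if "i < K" for i
          using arg_cong[OF eig[OF that], of "\<lambda>x. x * alt (Suc i)"]
          unfolding row[OF that] by (simp add: alt(1) algebra_simps)
      qed (use l w v right cut j alt(3) \<beta>' \<kappa>' in auto)
    qed
  qed
qed

end

section \<open>The cubic spline collocation matrix\<close>

lemma mono_if_unit_steps:
  fixes u :: "int \<Rightarrow> real"
  assumes "\<And>j. u j \<le> u (j + 1)" "i \<le> j"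
  shows "u i \<le> u j"
  using assms(2)
proof (induction j rule: int_ge_induct)
  case (step j)
  then show ?case using assms(1)[of j] by linarith
qed simp

text \<open>At a knot \<open>u i\<close> only the constant piece on \<open>[u i, u (i + 1))\<close> is active, so the recursion has one
  non-zero value in degrees 0 and 1, two in degree 2 and three in degree 3.\<close>

lemma bspline_3_at_knot:
  fixes u :: "int \<Rightarrow> real"
  assumes "mono u" and lt: "u i < u (i + 1)"
  shows "bspline u 3 (i - 3) (u i)
      = (u (i + 1) - u i) / (u (i + 1) - u (i - 2)) * ((u (i + 1) - u i) / (u (i + 1) - u (i - 1)))"
    and "bspline u 3 (i - 2) (u i)
      = (u i - u (i - 2)) / (u (i + 1) - u (i - 2)) * ((u (i + 1) - u i) / (u (i + 1) - u (i - 1)))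
        + (u (i + 2) - u i) / (u (i + 2) - u (i - 1)) * ((u i - u (i - 1)) / (u (i + 1) - u (i - 1)))"
    and "bspline u 3 (i - 1) (u i)
      = (u i - u (i - 1)) / (u (i + 2) - u (i - 1)) * ((u i - u (i - 1)) / (u (i + 1) - u (i - 1)))"
proof -
  have d0: "bspline u 0 j (u i) = (if j = i then 1 else 0)" for j
    using monoD[OF \<open>mono u\<close>, of "j + 1" i] monoD[OF \<open>mono u\<close>, of "i + 1" j] lt by (cases j i rule: linorder_cases) auto
  have d1: "bspline u (Suc 0) j (u i) = (if j = i - 1 then 1 else 0)" for j
  proof -
    consider "j = i" | "j = i - 1" | "j \<noteq> i" "j + 1 \<noteq> i" by linarith
    then show ?thesis
      using lt by cases (auto simp: d0 simp del: bspline.simps(1))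
  qed
  have d2: "bspline u (Suc (Suc 0)) j (u i)
      = (if j = i - 2 then (u (i + 1) - u i) / (u (i + 1) - u (i - 1))
         else if j = i - 1 then (u i - u (i - 1)) / (u (i + 1) - u (i - 1)) else 0)" for j
    unfolding bspline.simps(2)[of u "Suc 0"] d1 by (auto simp: algebra_simps)
  have d3: "bspline u 3 j (u i) = (u i - u j) / (u (j + 3) - u j) * bspline u (Suc (Suc 0)) j (u i)
      + (u (j + 4) - u i) / (u (j + 4) - u (j + 1)) * bspline u (Suc (Suc 0)) (j + 1) (u i)" for j
  proof -
    have "int (Suc (Suc (Suc 0))) = 3" "j + 3 + 1 = j + 4" by simp_all
    then show ?thesis
      unfolding numeral_3_eq_3 bspline.simps(2)[of u "Suc (Suc 0)"] by (simp only: refl)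
  qed
  show "bspline u 3 (i - 3) (u i)
      = (u (i + 1) - u i) / (u (i + 1) - u (i - 2)) * ((u (i + 1) - u i) / (u (i + 1) - u (i - 1)))"
    unfolding d3 d2 by (simp add: algebra_simps)
  show "bspline u 3 (i - 2) (u i)
      = (u i - u (i - 2)) / (u (i + 1) - u (i - 2)) * ((u (i + 1) - u i) / (u (i + 1) - u (i - 1)))
        + (u (i + 2) - u i) / (u (i + 2) - u (i - 1)) * ((u i - u (i - 1)) / (u (i + 1) - u (i - 1)))"
    unfolding d3 d2 by (simp add: algebra_simps)
  show "bspline u 3 (i - 1) (u i)
      = (u i - u (i - 1)) / (u (i + 2) - u (i - 1)) * ((u i - u (i - 1)) / (u (i + 1) - u (i - 1)))"
    unfolding d3 d2 by (simp add: algebra_simps)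
qed

text \<open>Here \<open>p, q, r, s\<close> are four consecutive knot gaps and \<open>a, b, c\<close> the entries of the row of the
  knot between \<open>q\<close> and \<open>r\<close>. The factor \<open>(q + r) / (q r)\<^sup>2\<close> solves the symmetry condition, because the resulting
  edge weights \<open>1 / (r\<^sup>2 (q + r + s))\<close> and \<open>1 / (q\<^sup>2 (p + q + r))\<close> are one formula shifted by one index. The
  last inequality leaves \<open>1 / (q r (p + q + r)) + 1 / (q r (q + r + s))\<close> to spare.\<close>

lemma spline_weights:
  fixes p q r s :: real
  assumes "0 \<le> p" "0 < q" "0 < r" "0 \<le> s"
  defines "\<delta> \<equiv> (q + r) / (q * r)\<^sup>2"
    and "a \<equiv> (p + q) / (p + q + r) * (r / (q + r)) + (r + s) / (q + r + s) * (q / (q + r))"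
    and "b \<equiv> q / (q + r + s) * (q / (q + r))"
    and "c \<equiv> r / (p + q + r) * (r / (q + r))"
  shows "a + b + c = 1"
    and "\<delta> * b = 1 / (r\<^sup>2 * (q + r + s))"
    and "\<delta> * c = 1 / (q\<^sup>2 * (p + q + r))"
    and "1 / (r\<^sup>2 * (q + r + s)) * s / q + 1 / (q\<^sup>2 * (p + q + r)) * p / r < \<delta> * a"
proof -
  have pos: "0 < q + r" "0 < p + q + r" "0 < q + r + s"
    using assms(1-4) by linarith+
  then have nz: "q + r \<noteq> 0" "p + q + r \<noteq> 0" "q + r + s \<noteq> 0" "q \<noteq> 0" "r \<noteq> 0"
    using assms(1-4) by auto
  have "a + b + c = ((p + q) + r) / (p + q + r) * (r / (q + r)) + (q + (r + s)) / (q + r + s) * (q / (q + r))"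
    unfolding a_def b_def c_def by (simp only: add_divide_distrib distrib_right)
  also have "\<dots> = r / (q + r) + q / (q + r)"
    using nz by (simp add: add.assoc)
  also have "\<dots> = 1"
    using nz by (simp add: add_divide_distrib[symmetric] add.commute)
  finally show "a + b + c = 1" .
  have \<delta>: "\<delta> * (r / (q + r)) = 1 / (q\<^sup>2 * r)" "\<delta> * (q / (q + r)) = 1 / (q * r\<^sup>2)"
    unfolding \<delta>_def using nz by (simp_all add: power2_eq_square)
  show "\<delta> * b = 1 / (r\<^sup>2 * (q + r + s))"
  proof -
    have "\<delta> * b = q / (q + r + s) * (\<delta> * (q / (q + r)))" by (simp add: b_def)
    also have "\<dots> = 1 / (r\<^sup>2 * (q + r + s))" unfolding \<delta> using nz by simp
    finally show ?thesis .
  qed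
  show "\<delta> * c = 1 / (q\<^sup>2 * (p + q + r))"
  proof -
    have "\<delta> * c = r / (p + q + r) * (\<delta> * (r / (q + r)))" by (simp add: c_def)
    also have "\<dots> = 1 / (q\<^sup>2 * (p + q + r))" unfolding \<delta> using nz by simp
    finally show ?thesis .
  qed
  have "\<delta> * a = (p + q) / (p + q + r) * (\<delta> * (r / (q + r))) + (r + s) / (q + r + s) * (\<delta> * (q / (q + r)))"
    by (simp add: a_def algebra_simps)
  also have "\<dots> = (p + q) / (p + q + r) * (1 / (q\<^sup>2 * r)) + (r + s) / (q + r + s) * (1 / (q * r\<^sup>2))"
    unfolding \<delta> ..
  also have "\<dots> = 1 / (r\<^sup>2 * (q + r + s)) * s / q + 1 / (q\<^sup>2 * (p + q + r)) * p / r
      + (1 / (q * r * (p + q + r)) + 1 / (q * r * (q + r + s)))"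
  proof -
    have "(p + q) / (p + q + r) * (1 / (q\<^sup>2 * r))
        = 1 / (q\<^sup>2 * (p + q + r)) * p / r + 1 / (q * r * (p + q + r))"
      using nz by (simp add: add_divide_distrib distrib_right power2_eq_square mult_ac)
    moreover have "(r + s) / (q + r + s) * (1 / (q * r\<^sup>2))
        = 1 / (r\<^sup>2 * (q + r + s)) * s / q + 1 / (q * r * (q + r + s))"
      using nz by (simp add: add_divide_distrib distrib_right power2_eq_square mult_ac)
    ultimately show ?thesis by simp
  qed
  moreover have "0 < 1 / (q * r * (p + q + r))" "0 < 1 / (q * r * (q + r + s))"
    using pos assms(1-4) by simp_all
  ultimately show "1 / (r\<^sup>2 * (q + r + s)) * s / q + 1 / (q\<^sup>2 * (p + q + r)) * p / r < \<delta> * a"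
    by linarith
qed

definition knot_gap :: "nat \<Rightarrow> (nat \<Rightarrow> real) \<Rightarrow> nat \<Rightarrow> real" where
  "knot_gap n t i = knot n t (int i + 1) - knot n t (int i)"

definition subdiag :: "nat \<Rightarrow> (nat \<Rightarrow> real) \<Rightarrow> nat \<Rightarrow> real" where
  "subdiag n t i = colloc_entry n t (i + 1) i"

definition maindiag :: "nat \<Rightarrow> (nat \<Rightarrow> real) \<Rightarrow> nat \<Rightarrow> real" where
  "maindiag n t i = colloc_entry n t (i + 1) (i + 1)"

definition superdiag :: "nat \<Rightarrow> (nat \<Rightarrow> real) \<Rightarrow> nat \<Rightarrow> real" where
  "superdiag n t i = colloc_entry n t (i + 1) (i + 2)"

lemma end_rows:
  "maindiag n t 0 = 1" "superdiag n t 0 = 0" "subdiag n t 0 = 0"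
  "1 \<le> n \<Longrightarrow> maindiag n t (n - 1) = 1" "1 \<le> n \<Longrightarrow> superdiag n t (n - 1) = 0"
  "2 \<le> n \<Longrightarrow> subdiag n t (n - 1) = 0"
  by (auto simp: maindiag_def superdiag_def subdiag_def colloc_entry_def)

lemma knot_gap_end: "1 \<le> n \<Longrightarrow> knot_gap n t 0 = 0" "1 \<le> n \<Longrightarrow> knot_gap n t n = 0"
  by (auto simp: knot_gap_def knot_def)

lemma knot_gap_pos:
  assumes "strict_mono_on {1..n} t" "1 \<le> i" "i < n"
  shows "0 < knot_gap n t i"
proof -
  have "knot n t (int i) = t i" "knot n t (int i + 1) = t (Suc i)"
    using assms by (auto simp: knot_def nat_add_distrib)
  moreover have "t i < t (Suc i)"
    using assms by (intro strict_mono_onD[OF assms(1)]) auto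
  ultimately show ?thesis
    by (simp add: knot_gap_def)
qed

lemma knot_mono:
  assumes "strict_mono_on {1..n} t" "1 \<le> n" "i \<le> j"
  shows "knot n t i \<le> knot n t j"
proof (rule mono_if_unit_steps[OF _ assms(3)])
  fix j
  consider "j < 1" | "1 \<le> j" "j < int n" | "int n \<le> j" by linarith
  then show "knot n t j \<le> knot n t (j + 1)"
  proof cases
    case 1
    then show ?thesis using assms(2) by (cases "j = 0") (auto simp: knot_def)
  next
    case 2
    then have "1 \<le> nat j" "nat j < n" by linarith+
    from knot_gap_pos[OF assms(1) this] 2 show ?thesis by (simp add: knot_gap_def)
  next
    case 3
    then show ?thesis using assms(2) by (auto simp: knot_def)
  qed
qed

lemma collocation_row:
  assumes "strict_mono_on {1..n} t" "Suc i + 1 < n"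
  defines "g \<equiv> knot_gap n t"
  shows "subdiag n t (Suc i) = g (i + 2) / (g i + g (i + 1) + g (i + 2)) * (g (i + 2) / (g (i + 1) + g (i + 2)))"
    and "maindiag n t (Suc i) = (g i + g (i + 1)) / (g i + g (i + 1) + g (i + 2)) * (g (i + 2) / (g (i + 1) + g (i + 2)))
      + (g (i + 2) + g (i + 3)) / (g (i + 1) + g (i + 2) + g (i + 3)) * (g (i + 1) / (g (i + 1) + g (i + 2)))"
    and "superdiag n t (Suc i) = g (i + 1) / (g (i + 1) + g (i + 2) + g (i + 3)) * (g (i + 1) / (g (i + 1) + g (i + 2)))"
proof -
  define u where "u = knot n t"
  define k where "k = int i + 2"
  have mono: "mono u"
    unfolding u_def using knot_mono[OF assms(1)] assms(2) by (intro monoI) simp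
  have lt: "u k < u (k + 1)"
    using knot_gap_pos[OF assms(1), of "i + 2"] assms(2) by (simp add: knot_gap_def u_def k_def add.commute)
  have t: "t (i + 2) = u k"
    using assms(2) by (auto simp: u_def k_def knot_def nat_add_distrib)
  have g: "g i = u (k - 1) - u (k - 2)" "g (i + 1) = u k - u (k - 1)"
    "g (i + 2) = u (k + 1) - u k" "g (i + 3) = u (k + 2) - u (k + 1)"
    by (simp_all add: g_def knot_gap_def u_def k_def algebra_simps)
  have e: "subdiag n t (Suc i) = bspline u 3 (k - 3) (u k)"
    "maindiag n t (Suc i) = bspline u 3 (k - 2) (u k)"
    "superdiag n t (Suc i) = bspline u 3 (k - 1) (u k)"
    using assms(2) unfolding t[symmetric]
    by (simp_all add: subdiag_def maindiag_def superdiag_def colloc_entry_def N3_def u_def k_def algebra_simps)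
  note B = bspline_3_at_knot[OF mono lt]
  show "subdiag n t (Suc i) = g (i + 2) / (g i + g (i + 1) + g (i + 2)) * (g (i + 2) / (g (i + 1) + g (i + 2)))"
    unfolding e B g by simp
  show "maindiag n t (Suc i) = (g i + g (i + 1)) / (g i + g (i + 1) + g (i + 2)) * (g (i + 2) / (g (i + 1) + g (i + 2)))
      + (g (i + 2) + g (i + 3)) / (g (i + 1) + g (i + 2) + g (i + 3)) * (g (i + 1) / (g (i + 1) + g (i + 2)))"
    unfolding e B g by simp
  show "superdiag n t (Suc i) = g (i + 1) / (g (i + 1) + g (i + 2) + g (i + 3)) * (g (i + 1) / (g (i + 1) + g (i + 2)))"
    unfolding e B g by simp
qed

text \<open>An edge of weight \<open>e i\<close> gets \<open>e i g (i + 2) / g i\<close> and \<open>e i g i / g (i + 2)\<close> from the diagonal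
  entries at its two ends. Their product is \<open>(e i)\<^sup>2\<close>, the least that makes the edge non-negative. The
  repeated end knots enter as gaps of length 0.\<close>

lemma collocation_positive_tridiagonal:
  assumes t: "strict_mono_on {1..n} t" and n: "2 \<le> n"
  defines "g \<equiv> knot_gap n t"
  shows "positive_tridiagonal (n - 2) (maindiag n t) (superdiag n t) (subdiag n t)
    (\<lambda>i. (g i + g (i + 1)) / (g i * g (i + 1))\<^sup>2)
    (\<lambda>i. 1 / ((g (i + 1))\<^sup>2 * (g i + g (i + 1) + g (i + 2))))"
proof -
  define K where "K = n - 2"
  have nK: "n = K + 2" using n by (simp add: K_def)
  define \<delta> where "\<delta> i = (g i + g (i + 1)) / (g i * g (i + 1))\<^sup>2" for i
  define e where "e i = 1 / ((g (i + 1))\<^sup>2 * (g i + g (i + 1) + g (i + 2)))" for i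
  have g_pos: "0 < g i" if "1 \<le> i" "i \<le> Suc K" for i
    unfolding g_def using knot_gap_pos[OF t, of i] that nK by simp
  have g_nonneg: "0 \<le> g i" if "i \<le> K + 2" for i
    using g_pos[of i] knot_gap_end[of n t] that nK
    by (cases "i = 0"; cases "i = K + 2") (auto simp: g_def)
  have row: "maindiag n t (Suc i) + superdiag n t (Suc i) + subdiag n t (Suc i) = 1"
    "\<delta> (Suc i) * superdiag n t (Suc i) = e (Suc i)"
    "\<delta> (Suc i) * subdiag n t (Suc i) = e i"
    "e (Suc i) * g (i + 3) / g (i + 1) + e i * g i / g (i + 2) < \<delta> (Suc i) * maindiag n t (Suc i)"
    if "i < K" for i
    using spline_weights[of "g i" "g (i + 1)" "g (i + 2)" "g (i + 3)"]
      g_pos[of "i + 1"] g_pos[of "i + 2"] g_nonneg[of i] g_nonneg[of "i + 3"] that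
      collocation_row[OF t, of i] nK
    by (simp_all add: \<delta>_def e_def g_def numeral_2_eq_2 numeral_3_eq_3)
  have e_pos: "0 < e i" if "i \<le> K" for i
    using g_pos[of "i + 1"] g_nonneg[of i] g_nonneg[of "i + 2"] that
    by (auto simp: e_def intro!: mult_pos_pos add_nonneg_pos add_pos_nonneg)
  interpret tridiagonal K "maindiag n t" "superdiag n t" "subdiag n t" \<delta> e
  proof
    show "0 < \<delta> (Suc i)" if "i < K" for i
      using g_pos[of "i + 1"] g_pos[of "i + 2"] that by (simp add: \<delta>_def numeral_2_eq_2)
    show "0 \<le> maindiag n t (Suc i)" if "i < K" for i
      using collocation_row(2)[OF t, of i] g_pos[of "i + 1"] g_pos[of "i + 2"]
        g_nonneg[of i] g_nonneg[of "i + 3"] that nK by (simp add: g_def)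
    show "maindiag n t (Suc K) = 1" "superdiag n t (Suc K) = 0" "subdiag n t (Suc K) = 0"
      using end_rows(4-6)[of n t] nK by simp_all
  qed (use row e_pos in auto)
  have "positive_tridiagonal K (maindiag n t) (superdiag n t) (subdiag n t) \<delta> e"
  proof
    fix f :: "nat \<Rightarrow> complex"
    assume f: "f 0 = 0" "f (Suc K) = 0" "\<exists>i<K. f (Suc i) \<noteq> 0"
    show "0 < Re (bform f f)"
    proof (rule bform_pos_by_weights[where \<xi> = "\<lambda>i. e i * g (i + 2) / g i"
          and \<eta> = "\<lambda>i. e i * g i / g (i + 2)", OF _ _ _ _ f])
      show "0 \<le> e i * g (i + 2) / g i" if "1 \<le> i" "i \<le> K" for i
        using e_pos[of i] g_nonneg[of i] g_nonneg[of "i + 2"] that by simp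
      show "0 \<le> e i * g i / g (i + 2)" if "i < K" for i
        using e_pos[of i] g_nonneg[of i] g_nonneg[of "i + 2"] that by simp
      show "(e i)\<^sup>2 \<le> e i * g (i + 2) / g i * (e i * g i / g (i + 2))" if "1 \<le> i" "i < K" for i
        using g_pos[of i] g_pos[of "i + 2"] that by (simp add: power2_eq_square)
      show "e (Suc i) * g (Suc i + 2) / g (Suc i) + e i * g i / g (i + 2) < \<delta> (Suc i) * maindiag n t (Suc i)"
        if "i < K" for i
        using row(4)[OF that] by (simp add: numeral_2_eq_2 numeral_3_eq_3)
    qed
  qed
  then show ?thesis
    unfolding K_def \<delta>_def e_def .
qed

section \<open>Eigenvalues of the preconditioned matrix\<close>

lemma precond_colloc_carrier:
  "colloc_mat n t \<in> carrier_mat n n" "precond_mat n t \<in> carrier_mat n n"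
  "cmat (precond_mat n t * colloc_mat n t) \<in> carrier_mat n n"
proof -
  show "colloc_mat n t \<in> carrier_mat n n" "precond_mat n t \<in> carrier_mat n n"
    by (simp_all add: precond_mat_def superdiag_mat_def colloc_mat_def)
  then show "cmat (precond_mat n t * colloc_mat n t) \<in> carrier_mat n n"
    by simp
qed

lemma colloc_mat_mult_vec:
  assumes v: "\<And>i. n \<le> i \<Longrightarrow> v i = 0" and n: "2 \<le> n" and i: "i < n"
  shows "(cmat (colloc_mat n t) *\<^sub>v vec n v) $ i
    = band_apply (maindiag n t) (superdiag n t) (subdiag n t) v i"
proof -
  have entry: "colloc_entry n t (i + 1) (j + 1) = (if j + 1 = i then subdiag n t i else 0)
      + (if j = i then maindiag n t i else 0) + (if j = i + 1 then superdiag n t i else 0)" for j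
    using n i by (auto simp: colloc_entry_def subdiag_def maindiag_def superdiag_def)
  have "(cmat (colloc_mat n t) *\<^sub>v vec n v) $ i
      = (\<Sum>j\<in>{0..<n}. of_real (colloc_entry n t (i + 1) (j + 1)) * v j)"
    using i by (simp add: scalar_prod_def colloc_mat_def)
  also have "\<dots> = (\<Sum>j\<in>{0..<n}. (if j + 1 = i then of_real (subdiag n t i) * v j else 0)
      + (if j = i then of_real (maindiag n t i) * v j else 0)
      + (if j = i + 1 then of_real (superdiag n t i) * v j else 0))"
    unfolding entry by (intro sum.cong refl) auto
  also have "\<dots> = (\<Sum>j\<in>{0..<n}. if j + 1 = i then of_real (subdiag n t i) * v j else 0)
      + (\<Sum>j\<in>{0..<n}. if j = i then of_real (maindiag n t i) * v j else 0)
      + (\<Sum>j\<in>{0..<n}. if j = i + 1 then of_real (superdiag n t i) * v j else 0)"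
    by (simp only: sum.distrib)
  also have "(\<Sum>j\<in>{0..<n}. if j + 1 = i then of_real (subdiag n t i) * v j else 0)
      = of_real (subdiag n t i) * v (i - 1)"
  proof (cases i)
    case 0
    then show ?thesis by (simp add: end_rows)
  next
    case (Suc k)
    then show ?thesis using i by simp
  qed
  also have "(\<Sum>j\<in>{0..<n}. if j = i then of_real (maindiag n t i) * v j else 0)
      = of_real (maindiag n t i) * v i"
    using i by simp
  also have "(\<Sum>j\<in>{0..<n}. if j = i + 1 then of_real (superdiag n t i) * v j else 0)
      = of_real (superdiag n t i) * v (Suc i)"
    using v[of "Suc i"] by simp
  finally show ?thesis
    by (simp add: band_apply_def)
qed

lemma precond_mat_mult_vec:
  assumes v: "\<And>i. n \<le> i \<Longrightarrow> v i = 0" and n: "2 \<le> n" and i: "i < n"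
  shows "(cmat (precond_mat n t) *\<^sub>v vec n v) $ i = v i - of_real (superdiag n t i) * v (Suc i)"
proof -
  have entry: "precond_mat n t $$ (i, j) = (if j = i then 1 else 0) - (if j = Suc i then superdiag n t i else 0)"
    if "j < n" for j
    using i that
    by (auto simp: precond_mat_def superdiag_mat_def colloc_mat_def superdiag_def)
  have "(cmat (precond_mat n t) *\<^sub>v vec n v) $ i
      = (\<Sum>j\<in>{0..<n}. of_real (precond_mat n t $$ (i, j)) * v j)"
    using i by (simp add: scalar_prod_def precond_mat_def superdiag_mat_def)
  also have "\<dots> = (\<Sum>j\<in>{0..<n}. (if j = i then v j else 0)
      - (if j = Suc i then of_real (superdiag n t i) * v j else 0))"
    by (intro sum.cong refl) (simp add: entry)
  also have "\<dots> = v i - of_real (superdiag n t i) * v (Suc i)"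
    using v[of "Suc i"] i by (simp add: sum_subtractf)
  finally show ?thesis .
qed

text \<open>The equations extend to the last row, since its superdiagonal entry is 0.\<close>

lemma precond_colloc_mult_vec:
  assumes v: "\<And>i. n \<le> i \<Longrightarrow> v i = 0" and n: "2 \<le> n" and i: "i < n"
  shows "(cmat (precond_mat n t * colloc_mat n t) *\<^sub>v vec n v) $ i
    = band_apply (maindiag n t) (superdiag n t) (subdiag n t) v i
      - of_real (superdiag n t i) * band_apply (maindiag n t) (superdiag n t) (subdiag n t) v (Suc i)"
proof -
  have car: "cmat (precond_mat n t) \<in> carrier_mat n n" "cmat (colloc_mat n t) \<in> carrier_mat n n"
    "precond_mat n t \<in> carrier_mat n n" "colloc_mat n t \<in> carrier_mat n n"
    by (simp_all add: precond_colloc_carrier)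
  define w where "w i = (if i < n then band_apply (maindiag n t) (superdiag n t) (subdiag n t) v i else 0)" for i
  have "cmat (colloc_mat n t) *\<^sub>v vec n v = vec n w"
  proof (rule eq_vecI)
    fix j assume "j < dim_vec (vec n w)"
    then show "(cmat (colloc_mat n t) *\<^sub>v vec n v) $ j = vec n w $ j"
      using colloc_mat_mult_vec[where v = v and i = j and t = t, OF v n] by (simp add: w_def del: index_mult_mat_vec)
  qed (use car in simp)
  moreover have "cmat (precond_mat n t * colloc_mat n t) *\<^sub>v vec n v
      = cmat (precond_mat n t) *\<^sub>v (cmat (colloc_mat n t) *\<^sub>v vec n v)"
    unfolding of_real_hom.mat_hom_mult[OF car(3,4)] by (rule assoc_mult_mat_vec[OF car(1,2)]) simp
  moreover have "(cmat (precond_mat n t) *\<^sub>v vec n w) $ i = w i - of_real (superdiag n t i) * w (Suc i)"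
    by (rule precond_mat_mult_vec) (use n i in \<open>simp_all add: w_def\<close>)
  ultimately have "(cmat (precond_mat n t * colloc_mat n t) *\<^sub>v vec n v) $ i
      = w i - of_real (superdiag n t i) * w (Suc i)"
    by (simp only:)
  also have "of_real (superdiag n t i) * w (Suc i) = of_real (superdiag n t i)
      * band_apply (maindiag n t) (superdiag n t) (subdiag n t) v (Suc i)"
  proof (cases "Suc i < n")
    case False
    then have "i = n - 1" using i by simp
    then show ?thesis using end_rows(5)[of n t] n by simp
  qed (simp add: w_def)
  finally show ?thesis
    using i by (simp add: w_def)
qed

lemma eigenvalue_precond_colloc_iff:
  assumes n: "2 \<le> n"
  shows "eigenvalue (cmat (precond_mat n t * colloc_mat n t)) z \<longleftrightarrow>
    (\<exists>v. (\<forall>i\<ge>n. v i = 0) \<and> (\<exists>i<n. v i \<noteq> 0) \<and> (\<forall>i<n. z * v i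
      = band_apply (maindiag n t) (superdiag n t) (subdiag n t) v i
        - of_real (superdiag n t i) * band_apply (maindiag n t) (superdiag n t) (subdiag n t) v (Suc i)))"
    (is "?L \<longleftrightarrow> (\<exists>v. ?R v)")
proof -
  define A where "A = cmat (precond_mat n t * colloc_mat n t)"
  have A: "A \<in> carrier_mat n n"
    unfolding A_def by (rule precond_colloc_carrier)
  have vec: "eigenvector A (vec n v) z \<longleftrightarrow> ?R v" if v: "\<forall>i\<ge>n. v i = 0" for v
  proof -
    have row: "(A *\<^sub>v vec n v) $ i = band_apply (maindiag n t) (superdiag n t) (subdiag n t) v i
        - of_real (superdiag n t i) * band_apply (maindiag n t) (superdiag n t) (subdiag n t) v (Suc i)"
      if "i < n" for i
      unfolding A_def by (rule precond_colloc_mult_vec) (use v n that in auto)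
    have "vec n v \<noteq> 0\<^sub>v n \<longleftrightarrow> (\<exists>i<n. v i \<noteq> 0)"
      by (auto simp: vec_eq_iff)
    moreover have "A *\<^sub>v vec n v = z \<cdot>\<^sub>v vec n v \<longleftrightarrow> (\<forall>i<n. z * v i = (A *\<^sub>v vec n v) $ i)"
    proof
      assume "A *\<^sub>v vec n v = z \<cdot>\<^sub>v vec n v"
      then show "\<forall>i<n. z * v i = (A *\<^sub>v vec n v) $ i"
        by (simp del: index_mult_mat_vec)
    next
      assume "\<forall>i<n. z * v i = (A *\<^sub>v vec n v) $ i"
      then show "A *\<^sub>v vec n v = z \<cdot>\<^sub>v vec n v"
        using A by (intro eq_vecI) (simp_all del: index_mult_mat_vec)
    qed
    moreover have "dim_row A = n" using A by simp
    ultimately show ?thesis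
      unfolding eigenvector_def using v row by simp
  qed
  show ?thesis
  proof
    assume ?L
    then obtain V where V: "eigenvector A V z"
      by (auto simp: eigenvalue_def A_def)
    define v where "v i = (if i < n then V $ i else 0)" for i
    have v0: "\<forall>i\<ge>n. v i = 0"
      by (simp add: v_def)
    have "V = vec n v"
      using V A by (auto simp: eigenvector_def v_def vec_eq_iff)
    from back_subst[of "\<lambda>V. eigenvector A V z", OF V this] show "\<exists>v. ?R v"
      using vec[of v] v0 by blast
  next
    assume "\<exists>v. ?R v"
    then show ?L
      unfolding eigenvalue_def A_def[symmetric] using vec by blast
  qed
qed

text \<open>The first row of \<open>Q B\<close> is the first unit vector, which is therefore a left eigenvector.\<close>

lemma eigenvalue_1_precond_colloc:
  assumes n: "2 \<le> n"
  shows "eigenvalue (cmat (precond_mat n t * colloc_mat n t)) 1"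
proof -
  define A where "A = cmat (precond_mat n t * colloc_mat n t)"
  have A: "A \<in> carrier_mat n n"
    unfolding A_def by (rule precond_colloc_carrier)
  have row0: "A $$ (0, j) = (if j = 0 then 1 else 0)" if "j < n" for j
  proof -
    define v :: "nat \<Rightarrow> complex" where "v i = (if i = j then 1 else 0)" for i
    have "A $$ (0, j) = (A *\<^sub>v vec n v) $ 0"
      using A that n by (simp add: scalar_prod_def v_def if_distrib cong: if_cong)
    also have "\<dots> = v 0"
      unfolding A_def using that n
      by (subst precond_colloc_mult_vec) (auto simp: v_def band_apply_def end_rows)
    finally show ?thesis by (simp add: v_def)
  qed
  have "eigenvector (transpose_mat A) (unit_vec n 0) 1"
    unfolding eigenvector_def
  proof (intro conjI)
    show "unit_vec n 0 \<noteq> (0\<^sub>v (dim_row (transpose_mat A)) :: complex vec)"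
      using A n by (auto simp: vec_eq_iff intro!: exI[of _ 0])
    show "transpose_mat A *\<^sub>v unit_vec n 0 = 1 \<cdot>\<^sub>v unit_vec n 0"
      using A row0 n by (auto simp: vec_eq_iff)
  qed (use A in auto)
  then have "eigenvalue (transpose_mat A) 1"
    by (auto simp: eigenvalue_def)
  then show ?thesis
    using eigenvalue_root_char_poly[OF A] eigenvalue_root_char_poly[of "transpose_mat A" n] A
    by (simp add: A_def[symmetric])
qed

text \<open>For \<open>n = 2\<close> there is no interior row; the matrix is the identity and \<open>m = 1\<close>.\<close>

lemma spectrum_in_sectors:
  assumes t: "strict_mono_on {1..n} t" and n: "2 \<le> n"
  obtains m :: real where "0 < m" "eigenvalue (cmat (precond_mat n t * colloc_mat n t)) (of_real m)"
    "\<And>z. eigenvalue (cmat (precond_mat n t * colloc_mat n t)) z \<Longrightarrow> sector (1 - z) \<and> sector (z - of_real m)"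
proof -
  define K where "K = n - 2"
  have nK: "n = Suc (Suc K)" using n by (simp add: K_def)
  define g where "g = knot_gap n t"
  define a b c where "a = maindiag n t" and "b = superdiag n t" and "c = subdiag n t"
  interpret positive_tridiagonal K a b c
    "\<lambda>i. (g i + g (i + 1)) / (g i * g (i + 1))\<^sup>2" "\<lambda>i. 1 / ((g (i + 1))\<^sup>2 * (g i + g (i + 1) + g (i + 2)))"
    unfolding K_def g_def a_def b_def c_def by (rule collocation_positive_tridiagonal[OF t n])
  let ?E = "eigenvalue (cmat (precond_mat n t * colloc_mat n t))"
  let ?eig = "\<lambda>z v. v 0 = 0 \<and> (\<forall>i>K. v i = 0) \<and> (\<exists>i<K. v (Suc i) \<noteq> 0) \<and>
    (\<forall>i<K. z * v (Suc i) = mult v (Suc i) - of_real (b (Suc i)) * mult v (Suc (Suc i)))"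
  have ends: "a 0 = 1" "b 0 = 0" "c 0 = 0"
    by (simp_all add: a_def b_def c_def end_rows)
  \<comment> \<open>Either the vector vanishes at both ends, or one of the trivial end rows forces \<open>z = 1\<close>.\<close>
  have E_iff: "?E z \<longleftrightarrow> z = 1 \<or> (\<exists>v. ?eig z v)" for z
  proof
    assume "?E z"
    then obtain v where v: "\<forall>i\<ge>n. v i = 0" "\<exists>i<n. v i \<noteq> 0"
      "\<forall>i<n. z * v i = mult v i - of_real (b i) * mult v (Suc i)"
      unfolding eigenvalue_precond_colloc_iff[OF n] a_def b_def c_def by blast
    have "z * v 0 = v 0" "z * v (Suc K) = v (Suc K)"
      using v(3)[rule_format, of 0] v(3)[rule_format, of "Suc K"] nK ends last_row
      by (simp_all add: band_apply_def)
    then have "z = 1 \<or> v 0 = 0 \<and> v (Suc K) = 0"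
      by auto
    moreover have "?eig z v" if "v 0 = 0" "v (Suc K) = 0"
    proof (intro conjI allI impI)
      show "v i = 0" if "i > K" for i
        using that v(1) \<open>v (Suc K) = 0\<close> nK by (cases "i = Suc K") auto
      obtain i where i: "i < n" "v i \<noteq> 0" using v(2) by blast
      then have "i \<noteq> 0" "i \<noteq> Suc K" using that by metis+
      then show "\<exists>i<K. v (Suc i) \<noteq> 0"
        using i nK by (intro exI[of _ "i - 1"]) auto
      show "z * v (Suc i) = mult v (Suc i) - of_real (b (Suc i)) * mult v (Suc (Suc i))" if "i < K" for i
        using v(3) that nK by simp
    qed (rule that(1))
    ultimately show "z = 1 \<or> (\<exists>v. ?eig z v)" by blast
  next
    assume "z = 1 \<or> (\<exists>v. ?eig z v)"
    then show "?E z"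
    proof
      assume "z = 1"
      then show ?thesis using eigenvalue_1_precond_colloc[OF n] by simp
    next
      assume "\<exists>v. ?eig z v"
      then obtain v where v: "v 0 = 0" "\<forall>i>K. v i = 0" "\<exists>i<K. v (Suc i) \<noteq> 0"
        "\<forall>i<K. z * v (Suc i) = mult v (Suc i) - of_real (b (Suc i)) * mult v (Suc (Suc i))"
        by blast
      have row: "z * v i = mult v i - of_real (b i) * mult v (Suc i)" if in_range: "i < n" for i
      proof -
        consider "i = 0" | "i = Suc K" | k where "i = Suc k" "k < K"
          using in_range nK by (cases i) (auto simp: less_Suc_eq)
        then show ?thesis
          using v ends last_row by cases (auto simp: band_apply_def)
      qed
      obtain k where "k < K" "v (Suc k) \<noteq> 0" using v(3) by blast
      then have "\<exists>i<n. v i \<noteq> 0" using nK by (intro exI[of _ "Suc k"]) simp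
      moreover have "\<forall>i\<ge>n. v i = 0" using v(2) nK by simp
      ultimately show ?thesis
        unfolding eigenvalue_precond_colloc_iff[OF n] using row[unfolded a_def b_def c_def] by blast
    qed
  qed
  have above: "sector (1 - z)" "0 < Re z" if "?eig z v" for z v
    using eigenvalue_bound_above[of v z] that by blast+
  show thesis
  proof (cases "K = 0")
    case True
    then have "?E z \<longleftrightarrow> z = 1" for z
      using E_iff by simp
    then show thesis
      by (intro that[of 1]) (simp_all add: sector_0)
  next
    case False
    then have "1 \<le> K" by simp
    then show thesis
    proof (rule smallest_eigenvalue)
      fix m v
      assume v: "v 0 = 0" "\<And>i. K < i \<Longrightarrow> v i = 0" "\<exists>i<K. v (Suc i) \<noteq> 0"
        "\<And>i. i < K \<Longrightarrow> of_real m * v (Suc i)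
          = mult v (Suc i) - of_real (b (Suc i)) * mult v (Suc (Suc i))"
        and below: "\<And>z v. v 0 = 0 \<Longrightarrow> (\<And>i. K < i \<Longrightarrow> v i = 0) \<Longrightarrow> (\<exists>i<K. v (Suc i) \<noteq> 0) \<Longrightarrow>
          (\<And>i. i < K \<Longrightarrow> z * v (Suc i) = mult v (Suc i) - of_real (b (Suc i)) * mult v (Suc (Suc i)))
          \<Longrightarrow> sector (z - of_real m)"
      have eig: "?eig (of_real m) v" using v by blast
      show thesis
      proof (rule that[of m])
        show "0 < m" using above(2)[OF eig] by simp
        show "?E (of_real m)" using E_iff eig by blast
        show "sector (1 - z) \<and> sector (z - of_real m)" if "?E z" for z
        proof (cases "z = 1")
          case True
          then show ?thesis using above(1)[OF eig] by (simp add: sector_0)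
        next
          case False
          then obtain u where u: "?eig z u" using E_iff \<open>?E z\<close> by blast
          then show ?thesis using above(1)[OF u] below[of u z] by blast
        qed
      qed
    qed
  qed
qed

text \<open>The product of the two sector bounds is three times stronger than the equation
  \<open>(Im z)\<^sup>2 \<le> (1 - Re z) (Re z - m)\<close> of the disc with diameter from \<open>m\<close> to 1.\<close>

lemma disc_if_sectors:
  assumes "sector (1 - z)" "sector (z - of_real m)"
  shows "(cmod (of_real (1 + m) - 2 * z))\<^sup>2 \<le> (1 - m)\<^sup>2"
    and "m \<le> Re z" and "Re z \<le> 1"
proof -
  have *: "sqrt 3 * \<bar>Im z\<bar> \<le> 1 - Re z" "sqrt 3 * \<bar>Im z\<bar> \<le> Re z - m"
    using assms by (simp_all add: sector_def)
  have nonneg: "0 \<le> sqrt 3 * \<bar>Im z\<bar>" by simp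
  show "m \<le> Re z" "Re z \<le> 1" using * nonneg by linarith+
  have "(sqrt 3 * \<bar>Im z\<bar>) * (sqrt 3 * \<bar>Im z\<bar>) \<le> (1 - Re z) * (Re z - m)"
    using * nonneg by (intro mult_mono) linarith+
  then have "3 * (Im z)\<^sup>2 \<le> (1 - Re z) * (Re z - m)"
    by (simp add: power2_eq_square algebra_simps)
  then have "(Im z)\<^sup>2 \<le> (1 - Re z) * (Re z - m)"
    using zero_le_power2[of "Im z"] by linarith
  then show "(cmod (of_real (1 + m) - 2 * z))\<^sup>2 \<le> (1 - m)\<^sup>2"
    unfolding cmod_power2 by (simp add: power2_eq_square algebra_simps)
qed

lemma eigenvalue_one_minus_smult:
  fixes A :: "complex mat"
  assumes A: "A \<in> carrier_mat n n"
  shows "eigenvalue A z \<Longrightarrow> eigenvalue (1\<^sub>m n - \<omega> \<cdot>\<^sub>m A) (1 - \<omega> * z)"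
    and "\<omega> \<noteq> 0 \<Longrightarrow> eigenvalue (1\<^sub>m n - \<omega> \<cdot>\<^sub>m A) y \<Longrightarrow> \<exists>z. eigenvalue A z \<and> y = 1 - \<omega> * z"
proof -
  have mult: "(1\<^sub>m n - \<omega> \<cdot>\<^sub>m A) *\<^sub>v v = v - \<omega> \<cdot>\<^sub>v (A *\<^sub>v v)" if "v \<in> carrier_vec n" for v
  proof -
    have "(\<omega> \<cdot>\<^sub>m A) *\<^sub>v v = \<omega> \<cdot>\<^sub>v (A *\<^sub>v v)"
      using A that by (intro eq_vecI) (auto simp: scalar_prod_def sum_distrib_left mult.assoc)
    then show ?thesis
      using A that by (simp add: minus_mult_distrib_mat_vec[of _ n n])
  qed
  show "eigenvalue (1\<^sub>m n - \<omega> \<cdot>\<^sub>m A) (1 - \<omega> * z)" if "eigenvalue A z"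
  proof -
    from that obtain v where v: "v \<in> carrier_vec n" "v \<noteq> 0\<^sub>v n" "A *\<^sub>v v = z \<cdot>\<^sub>v v"
      using A by (auto simp: eigenvalue_def eigenvector_def)
    have "(1\<^sub>m n - \<omega> \<cdot>\<^sub>m A) *\<^sub>v v = (1 - \<omega> * z) \<cdot>\<^sub>v v"
      unfolding mult[OF v(1)] v(3) using v(1) by (intro eq_vecI) (auto simp: algebra_simps)
    then show ?thesis
      using A v by (auto simp: eigenvalue_def eigenvector_def)
  qed
  show "\<exists>z. eigenvalue A z \<and> y = 1 - \<omega> * z" if "\<omega> \<noteq> 0" "eigenvalue (1\<^sub>m n - \<omega> \<cdot>\<^sub>m A) y"
  proof -
    from that(2) obtain v where v: "v \<in> carrier_vec n" "v \<noteq> 0\<^sub>v n" "v - \<omega> \<cdot>\<^sub>v (A *\<^sub>v v) = y \<cdot>\<^sub>v v"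
      using A mult by (auto simp: eigenvalue_def eigenvector_def)
    have "A *\<^sub>v v = ((1 - y) / \<omega>) \<cdot>\<^sub>v v"
    proof (intro eq_vecI)
      fix i assume "i < dim_vec (((1 - y) / \<omega>) \<cdot>\<^sub>v v)"
      then have i: "i < n" using v(1) by simp
      have "v $ i - \<omega> * (A *\<^sub>v v) $ i = y * v $ i"
        using arg_cong[OF v(3), of "\<lambda>x. x $ i"] i v(1) A by simp
      then show "(A *\<^sub>v v) $ i = (((1 - y) / \<omega>) \<cdot>\<^sub>v v) $ i"
        using i v(1) that(1) by (simp add: field_simps)
    qed (use A v in auto)
    then have "eigenvalue A ((1 - y) / \<omega>)"
      using A v by (auto simp: eigenvalue_def eigenvector_def)
    then show ?thesis
      using that(1) by (intro exI[of _ "(1 - y) / \<omega>"]) simp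
  qed
qed

theorem theorem3:
  fixes n d :: nat and t :: "nat \<Rightarrow> real" and p :: "real mat"
    and \<mu> :: "nat \<Rightarrow> complex" and \<omega> :: real
  assumes n: "n \<ge> 2"
    and d: "d = 2 \<or> d = 3"
    and t: "strict_mono_on {1..n} t"
    and p: "p \<in> carrier_mat n d"
    and eigenvalues:
      "char_poly (cmat (precond_mat n t * colloc_mat n t)) = (\<Prod>i = 1..n. [:- \<mu> i, 1:])"
    and \<omega>: "\<omega> = 2 / (Min ((\<lambda>i. cmod (\<mu> i)) ` {1..n}) + Max ((\<lambda>i. cmod (\<mu> i)) ` {1..n}))"
  shows "convergent_iteration (precond_wpia n t p (complex_of_real \<omega>)) \<and>
    fastest_iteration (precond_wpia n t p (complex_of_real \<omega>))
      {precond_wpia n t p \<omega>' | \<omega>' :: complex. True}"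
proof -
  define A where "A = cmat (precond_mat n t * colloc_mat n t)"
  have A: "A \<in> carrier_mat n n"
    unfolding A_def by (rule precond_colloc_carrier)
  have E_iff: "eigenvalue A z \<longleftrightarrow> z \<in> \<mu> ` {1..n}" for z
    unfolding eigenvalue_root_char_poly[OF A] eigenvalues[folded A_def]
    by (auto simp: poly_prod prod_zero_iff)
  obtain m :: real where m: "0 < m" "eigenvalue A (of_real m)"
    and sectors: "\<And>z. eigenvalue A z \<Longrightarrow> sector (1 - z) \<and> sector (z - of_real m)"
    using spectrum_in_sectors[OF t n] unfolding A_def by blast
  have one: "eigenvalue A 1"
    unfolding A_def by (rule eigenvalue_1_precond_colloc[OF n])
  have "m \<le> 1"
    using disc_if_sectors(3)[of "of_real m" m] sectors[OF m(2)] by simp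
  have ge: "m \<le> cmod z" and le: "cmod z \<le> 1"
    and disc: "cmod (of_real (1 + m) - 2 * z) \<le> 1 - m" if "eigenvalue A z" for z
  proof -
    note D = disc_if_sectors[of z m, OF conjunct1[OF sectors[OF that]] conjunct2[OF sectors[OF that]]]
    show "m \<le> cmod z"
      using D(2) complex_Re_le_cmod[of z] by linarith
    show disc: "cmod (of_real (1 + m) - 2 * z) \<le> 1 - m"
      by (rule power2_le_imp_le[OF D(1)]) (use \<open>m \<le> 1\<close> in simp)
    have "2 * cmod z = cmod (of_real (1 + m) - (of_real (1 + m) - 2 * z))"
      by (simp add: norm_mult)
    also have "\<dots> \<le> cmod (of_real (1 + m)) + cmod (of_real (1 + m) - 2 * z)"
      by (rule norm_triangle_ineq4)
    also have "\<dots> \<le> (1 + m) + (1 - m)"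
    proof (rule add_mono)
      show "cmod (of_real (1 + m)) \<le> 1 + m"
        unfolding norm_of_real using m(1) by simp
    qed (rule disc)
    finally show "cmod z \<le> 1" by simp
  qed
  have eig_\<mu>: "eigenvalue A (\<mu> i)" if "i \<in> {1..n}" for i
    unfolding E_iff using that by (rule imageI)
  have "Min ((\<lambda>i. cmod (\<mu> i)) ` {1..n}) = m"
  proof (rule Min_eqI)
    obtain i where "i \<in> {1..n}" "\<mu> i = of_real m"
      using m(2) unfolding E_iff by (elim imageE) simp
    then show "m \<in> (\<lambda>i. cmod (\<mu> i)) ` {1..n}"
      using m(1) by (intro image_eqI[of _ _ i]) simp_all
    show "m \<le> y" if "y \<in> (\<lambda>i. cmod (\<mu> i)) ` {1..n}" for y
      using that ge[OF eig_\<mu>] by blast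
  qed simp
  moreover have "Max ((\<lambda>i. cmod (\<mu> i)) ` {1..n}) = 1"
  proof (rule Max_eqI)
    obtain i where "i \<in> {1..n}" "\<mu> i = 1"
      using one unfolding E_iff by (elim imageE) simp
    then show "1 \<in> (\<lambda>i. cmod (\<mu> i)) ` {1..n}" by (intro image_eqI[of _ _ i]) auto
    show "y \<le> 1" if "y \<in> (\<lambda>i. cmod (\<mu> i)) ` {1..n}" for y
      using that le[OF eig_\<mu>] by blast
  qed simp
  ultimately have \<omega>': "\<omega> = 2 / (1 + m)"
    using \<omega> by (simp add: add.commute)
  define G where "G x = 1\<^sub>m n - x \<cdot>\<^sub>m A" for x
  have G: "G x \<in> carrier_mat n n" for x
    unfolding G_def by (intro minus_carrier_mat smult_carrier_mat A)
  have "n > 0" using n by simp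
  have upper: "spectral_radius (G (of_real \<omega>)) \<le> (1 - m) / (1 + m)"
  proof -
    obtain y where y: "eigenvalue (G (of_real \<omega>)) y" "spectral_radius (G (of_real \<omega>)) = cmod y"
      using spectral_radius_mem_max(1)[OF G \<open>n > 0\<close>] by (auto simp: spectrum_def)
    have "0 < \<omega>" unfolding \<omega>' using m(1) by simp
    then have "complex_of_real \<omega> \<noteq> 0" by simp
    then obtain z where z: "eigenvalue A z" "y = 1 - of_real \<omega> * z"
      using eigenvalue_one_minus_smult(2)[OF A] y(1) unfolding G_def by blast
    have "complex_of_real (1 + m) \<noteq> 0"
      using m(1) by (simp only: of_real_eq_0_iff)
    then have "y = (of_real (1 + m) - 2 * z) / of_real (1 + m)"
      unfolding z(2) \<omega>' by (simp add: field_simps)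
    then have "cmod y = cmod (of_real (1 + m) - 2 * z) / (1 + m)"
      using m(1) by (simp only: norm_divide norm_of_real)
    also have "\<dots> \<le> (1 - m) / (1 + m)"
      using disc[OF z(1)] m(1) by (intro divide_right_mono) auto
    finally show ?thesis using y(2) by simp
  qed
  have lower: "(1 - m) / (1 + m) \<le> spectral_radius (G x)" for x
  proof -
    have ev: "cmod (1 - x * z) \<le> spectral_radius (G x)" if "eigenvalue A z" for z
      using spectral_radius_mem_max(2)[OF G \<open>n > 0\<close>] eigenvalue_one_minus_smult(1)[OF A that, of x]
      by (auto simp: spectrum_def G_def)
    have "of_real (1 - m) = (1 - x * of_real m) - of_real m * (1 - x * 1)"
      by (simp add: algebra_simps)
    then have "cmod (of_real (1 - m)) \<le> cmod (1 - x * of_real m) + cmod (of_real m * (1 - x * 1))"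
      by (metis norm_triangle_ineq4)
    also have "\<dots> \<le> spectral_radius (G x) + m * spectral_radius (G x)"
      using ev[OF m(2)] ev[OF one] m(1) by (intro add_mono) (simp_all add: norm_mult)
    also have "cmod (of_real (1 - m)) = 1 - m"
      using \<open>m \<le> 1\<close> by (simp only: norm_of_real)
    finally show ?thesis
      using m(1) by (simp add: pos_divide_le_eq algebra_simps)
  qed
  have iter: "iteration_matrix (precond_wpia n t p x) = G x" for x
    by (simp add: iteration_matrix_def precond_wpia_def G_def A_def)
  have "(1 - m) / (1 + m) < 1"
    using m(1) by simp
  then have "convergent_iteration (precond_wpia n t p (of_real \<omega>))"
    unfolding convergent_iteration_def iter using upper by linarith
  moreover have "fastest_iteration (precond_wpia n t p (of_real \<omega>)) {precond_wpia n t p x | x. True}"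
    unfolding fastest_iteration_def
  proof (intro conjI ballI)
    fix J assume "J \<in> {precond_wpia n t p x | x. True}"
    then obtain x where "J = precond_wpia n t p x" by blast
    then show "spectral_radius (iteration_matrix (precond_wpia n t p (of_real \<omega>)))
        \<le> spectral_radius (iteration_matrix J)"
      using order_trans[OF upper lower[of x]] by (simp only: iter)
  qed blast
  ultimately show ?thesis by (rule conjI)
qed

end
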